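(* Let $X$ be a set of infinite regular cardinality $\kappa$. The maximal clones on $X$ which contain all permutations of $X$ but not all unary functions on $X$ are exactly the clones of the form $\operatorname{Pol}(\mathcal{G})$, where $\mathcal{G}\in\{\mathcal{A},\mathcal{B},\mathcal{E},\mathcal{F}\}\cup\{\mathcal{G}_\lambda : 1\le\lambda\le\kappa,\ \lambda \text{ a cardinal}\}$ is one of the following submonoids of the monoid $\mathcal{O}^{(1)}$ of all functions $X\to X$: (1) $\mathcal{A}=\{f\in\mathcal{O}^{(1)} : f^{-1}[y]\text{ is small for almost all } y\in X\}$; (2) $\mathcal{B}=\{f\in\mathcal{O}^{(1)} : f^{-1}[y]\text{ is small for all } y\in X\}$; (3) $\mathcal{E}=\{f\in\mathcal{O}^{(1)} : f\text{ is almost surjective}\}$; (4) $\mathcal{F}=\{f\in\mathcal{O}^{(1)} : f\text{ is almost surjective or constant}\}$; (5) $\mathcal{G}_\lambda=\{f\in\mathcal{O}^{(1)} : \text{if } A\subseteq X \text{ has cardinality } \lambda \text{ then } |X\setminus f[X\setminus A]|\ge\lambda\}$.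
   Context: For $n\ge 1$, $\mathcal{O}^{(n)}$ is the set of all functions $X^n\to X$, and $\mathcal{O}=\bigcup_{n\ge1}\mathcal{O}^{(n)}$. A clone on $X$ is a subset of $\mathcal{O}$ containing all projections and closed under composition. A maximal clone is a dual atom of the lattice of clones on $X$ (ordered by inclusion), i.e. a clone $\mathcal{C}\ne\mathcal{O}$ such that no clone lies strictly between $\mathcal{C}$ and $\mathcal{O}$. A submonoid of $\mathcal{O}^{(1)}$ is a set of unary functions containing the identity and closed under composition. For $\mathcal{G}\subseteq\mathcal{O}^{(1)}$, $\operatorname{Pol}(\mathcal{G})$ is the clone of all $f\in\mathcal{O}^{(n)}$, $n\ge1$, such that $f(g_1,\dots,g_n)\in\mathcal{G}$ whenever $g_1,\dots,g_n\in\mathcal{G}$, where $f(g_1,\dots,g_n)(x)=f(g_1(x),\dots,g_n(x))$. A subset of $X$ is small if its cardinality is less than $\kappa=|X|$. A property holds for almost all $y\in X$ if the set of $y$ for which it fails is small. A function $f\in\mathcal{O}^{(1)}$ is almost surjective if $X\setminus f[X]$ is small. *)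

theory Defs
  imports Main "HOL-Library.FuncSet"
begin

unbundle cardinal_syntax

(* The base set X is the universe of the type 'a, and X^n is the set of lists of length n. *)

definition tuples :: "nat \<Rightarrow> 'a list set" where
  "tuples n = {xs. length xs = n}"

definition ops :: "nat \<Rightarrow> ('a list \<Rightarrow> 'a) set" where
  "ops n = tuples n \<rightarrow>\<^sub>E UNIV"

(* Operations are tagged with their arity because extensional functions on tuples of different
   lengths need not differ: the one with constant value undefined lies in every set ops n. *)

type_synonym 'a operation = "nat \<times> ('a list \<Rightarrow> 'a)"

definition all_ops :: "'a operation set" where
  "all_ops = (SIGMA n:{1..}. ops n)"

definition proj :: "nat \<Rightarrow> nat \<Rightarrow> 'a operation" where
  "proj n i = (n, \<lambda>xs\<in>tuples n. xs ! i)"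

definition compose_op :: "nat \<Rightarrow> ('a list \<Rightarrow> 'a) \<Rightarrow> ('a list \<Rightarrow> 'a) list \<Rightarrow> 'a operation" where
  "compose_op m f gs = (m, \<lambda>xs\<in>tuples m. f (map (\<lambda>g. g xs) gs))"

definition clone :: "'a operation set \<Rightarrow> bool" where
  "clone C \<longleftrightarrow> C \<subseteq> all_ops \<and>
     (\<forall>n\<ge>1. \<forall>i<n. proj n i \<in> C) \<and>
     (\<forall>n m f gs. (n, f) \<in> C \<and> m \<ge> 1 \<and> length gs = n \<and> (\<forall>g\<in>set gs. (m, g) \<in> C)
        \<longrightarrow> compose_op m f gs \<in> C)"

definition maximal_clone :: "'a operation set \<Rightarrow> bool" where
  "maximal_clone C \<longleftrightarrow> clone C \<and> C \<noteq> all_ops \<and> \<not> (\<exists>D. clone D \<and> C \<subset> D \<and> D \<subset> all_ops)"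

(* Unary operations are identified with functions on 'a: the range of unary is the set of all
   operations of arity 1. *)

definition unary :: "('a \<Rightarrow> 'a) \<Rightarrow> 'a operation" where
  "unary g = (1, \<lambda>xs\<in>tuples 1. g (xs ! 0))"

definition submonoid_of_functions :: "('a \<Rightarrow> 'a) set \<Rightarrow> bool" where
  "submonoid_of_functions G \<longleftrightarrow> id \<in> G \<and> (\<forall>f\<in>G. \<forall>g\<in>G. f \<circ> g \<in> G)"

definition Pol :: "('a \<Rightarrow> 'a) set \<Rightarrow> 'a operation set" where
  "Pol G = {(n, f) \<in> all_ops.
     \<forall>gs. length gs = n \<and> set gs \<subseteq> G \<longrightarrow> (\<lambda>x. f (map (\<lambda>g. g x) gs)) \<in> G}"

definition small :: "'a set \<Rightarrow> bool" where
  "small A \<longleftrightarrow> |A| <o |UNIV :: 'a set|"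

definition almost_all :: "('a \<Rightarrow> bool) \<Rightarrow> bool" where
  "almost_all P \<longleftrightarrow> small {y. \<not> P y}"

definition almost_surj :: "('a \<Rightarrow> 'a) \<Rightarrow> bool" where
  "almost_surj f \<longleftrightarrow> small (UNIV - range f)"

definition monoid_A :: "('a \<Rightarrow> 'a) set" where
  "monoid_A = {f. almost_all (\<lambda>y. small (f -` {y}))}"

definition monoid_B :: "('a \<Rightarrow> 'a) set" where
  "monoid_B = {f. \<forall>y. small (f -` {y})}"

definition monoid_E :: "('a \<Rightarrow> 'a) set" where
  "monoid_E = {f. almost_surj f}"

definition monoid_F :: "('a \<Rightarrow> 'a) set" where
  "monoid_F = {f. almost_surj f \<or> (\<exists>c. f = (\<lambda>_. c))}"

(* Every cardinal that is at most the cardinality of 'a is represented, up to ordIso, by a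
   cardinal order on a subset of 'a, so it suffices to take the index in the type 'a rel. *)

definition monoid_G :: "'a rel \<Rightarrow> ('a \<Rightarrow> 'a) set" where
  "monoid_G l = {f. \<forall>A. |A| =o l \<longrightarrow> l \<le>o |UNIV - f ` (UNIV - A)|}"

definition listed_monoids :: "('a \<Rightarrow> 'a) set set" where
  "listed_monoids = {monoid_A, monoid_B, monoid_E, monoid_F} \<union>
     {monoid_G l | l. Card_order l \<and> cone \<le>o l \<and> l \<le>o |UNIV :: 'a set|}"

end

theory Submission
  imports Defs
begin

text \<open>
  Let \<open>C\<close> be a clone containing the permutations, let \<open>M\<close> be its unary part, and suppose that \<open>C\<close> is
  contained in no \<open>Pol G\<close> with \<open>G\<close> listed. Operations witnessing this for \<open>\<B>\<close> and \<open>\<A>\<close> give members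
  of \<open>M\<close> with one, then with many large fibres; those for the \<open>\<G>\<^sub>\<lambda>\<close> then show that every function on
  a set with large complement extends to a member of \<open>M\<close>; those for \<open>\<E>\<close> and \<open>\<F>\<close> yield a non-constant
  member that is not almost surjective. If no such member has a large range, then \<open>C\<close> consists of
  almost unary operations. Otherwise \<open>M\<close> contains all functions without small non-empty fibres, and
  then all functions, unless \<open>C\<close> preserves the set of functions with a large fibre.

  The almost unary operations and the operations preserving the functions with a large fibre form
  proper clones containing all unary operations. Hence a maximal clone containing the permutations
  but not all unary functions is not contained in these two, and so lies in some \<open>Pol G\<close>.
  Conversely, every \<open>Pol G\<close> contains a binary operation that is injective on the square of a large
  set, so a clone \<open>D\<close> properly above \<open>Pol G\<close> is not contained in these two either; as the clones
  \<open>Pol G\<close> are pairwise incomparable, \<open>D\<close> contains all unary operations, and together with the binary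
  operation they generate everything.
\<close>

subsection \<open>Small and large sets\<close>

text \<open>The obstacle is that an operation of \<open>C\<close> outside \<open>Pol G\<close> is
  witnessed by arguments from \<open>G\<close>, while at first nothing is known of \<open>M\<close>
  except that it contains the permutations. So each witness is thinned to a set V with large
  complement on which every argument agrees with some member of \<open>M\<close>: because it is
  injective there, or constant, or because it misses enough points. The operation can then be
  applied inside \<open>M\<close>, and the violation survives on V. Values off V stay uncontrolled,
  so only properties that extra arguments cannot destroy are carried over: large fibres, and
  covering almost all values. This fixes the order of the monoids: failing \<open>monoid_B\<close>
  supplies the constants needed for \<open>monoid_A\<close>, both together supply the functions
  needed for \<open>monoid_G\<close>, and so on. Two tools do the rest. A member of \<open>M\<close>
  whose range has large complement may be followed by an arbitrary function, once partial functions
  extend. And functions all of whose non-empty fibres are large are equal up to a permutation of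
  arguments as soon as they have the same range, so for them membership in \<open>M\<close> is a
  question about ranges.\<close>

abbreviation large :: "'a set \<Rightarrow> bool" where
  "large A \<equiv> \<not> small A"

lemma small_mono: "A \<subseteq> B \<Longrightarrow> small B \<Longrightarrow> small A"
  unfolding small_def using card_of_mono1 ordLeq_ordLess_trans by blast

lemma large_iff: "large (A :: 'a set) \<longleftrightarrow> |UNIV :: 'a set| \<le>o |A|"
  unfolding small_def using not_ordLess_iff_ordLeq card_of_Well_order by blast

lemma large_iff_ordIso: "large (A :: 'a set) \<longleftrightarrow> |A| =o |UNIV :: 'a set|"
  unfolding large_iff using card_of_mono1[of A UNIV] ordIso_iff_ordLeq by blast

lemma large_UNIV [simp]: "large (UNIV :: 'a set)"
  unfolding small_def using ordLess_irreflexive by blast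

lemma bij_betw_large:
  assumes "large (A :: 'a set)" "large (B :: 'a set)"
  obtains f where "bij_betw f A B"
proof -
  have "|A| =o |B|"
    using assms large_iff_ordIso ordIso_transitive ordIso_symmetric by blast
  then show thesis
    using that card_of_ordIso by blast
qed

lemma small_image: "small (A :: 'a set) \<Longrightarrow> small (f ` A :: 'a set)"
  unfolding small_def using card_of_image ordLeq_ordLess_trans by blast

lemma large_inj_image: "large (A :: 'a set) \<Longrightarrow> inj_on f A \<Longrightarrow> large (f ` A :: 'a set)"
  by (metis large_iff_ordIso card_of_ordIsoI inj_on_imp_bij_betw ordIso_symmetric ordIso_transitive)

lemma large_vimage:
  fixes f :: "'a \<Rightarrow> 'a"
  assumes "large B" "B \<subseteq> f ` A"
  shows "large (f -` B \<inter> A)"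
proof
  assume "small (f -` B \<inter> A)"
  then have "small (f ` (f -` B \<inter> A))"
    by (rule small_image)
  moreover have "f ` (f -` B \<inter> A) = B"
    using assms(2) by auto
  ultimately show False
    using assms(1) by simp
qed

text \<open>\<open>ty\<close> anchors the type variable, so that the cardinality assumptions on its
  universe can be shared by the locales built on top.\<close>

locale regular_universe =
  fixes ty :: "'a itself"
  assumes infinite_UNIV: "infinite (UNIV :: 'a set)"
    and regular: "regularCard |UNIV :: 'a set|"
begin

lemma Cinfinite_UNIV: "Cinfinite |UNIV :: 'a set|"
  using infinite_UNIV by (simp add: cinfinite_def Field_card_of card_of_Card_order card_of_card_order_on)

lemma small_finite: "finite (A :: 'a set) \<Longrightarrow> small A"
  unfolding small_def using infinite_UNIV finite_ordLess_infinite[OF card_of_Well_order card_of_Well_order]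
  by (simp add: Field_card_of)

lemma small_Un: "small (A :: 'a set) \<Longrightarrow> small B \<Longrightarrow> small (A \<union> B)"
  unfolding small_def using card_of_Un_ordLess_infinite infinite_UNIV by blast

lemma small_Un_iff: "small (A \<union> B :: 'a set) \<longleftrightarrow> small A \<and> small B"
  using small_Un small_mono[of A "A \<union> B"] small_mono[of B "A \<union> B"] by auto

text \<open>Regularity of |X| enters here. The index set may live in any type, which transfinite
  choice along an arbitrary index type requires.\<close>

lemma small_UN_general:
  assumes "|I| <o |UNIV :: 'a set|" "\<And>i. i \<in> I \<Longrightarrow> small (A i :: 'a set)"
  shows "small (\<Union>i\<in>I. A i)"
  unfolding small_def
  by (rule card_of_UNION_ordLess_infinite_Field_regularCard[OF regular Cinfinite_UNIV assms(1)])
    (use assms(2) in \<open>simp add: small_def\<close>)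

lemma small_UN:
  "small (I :: 'a set) \<Longrightarrow> (\<And>i. i \<in> I \<Longrightarrow> small (A i :: 'a set)) \<Longrightarrow> small (\<Union>i\<in>I. A i)"
  using small_UN_general[of I A] by (simp add: small_def)

lemma small_UN_finite:
  "finite I \<Longrightarrow> (\<And>i. i \<in> I \<Longrightarrow> small (A i :: 'a set)) \<Longrightarrow> small (\<Union>i\<in>I. A i)"
  by (rule small_UN_general)
    (use finite_ordLess_infinite[OF card_of_Well_order card_of_Well_order] infinite_UNIV
     in \<open>auto simp: Field_card_of\<close>)

lemma large_Diff: "large (A :: 'a set) \<Longrightarrow> small B \<Longrightarrow> large (A - B)"
  using small_Un[of "A - B" B] small_mono[of A "A - B \<union> B"] by blast

lemma large_not_empty: "large (A :: 'a set) \<Longrightarrow> A \<noteq> {}"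
  using small_finite by auto

lemma large_Compl_small: "small (A :: 'a set) \<Longrightarrow> large (- A)"
  using large_Diff[of UNIV A] by (simp add: Compl_eq_Diff_UNIV)

text \<open>X is equipotent with X * (X * nat); forgetting the first factor leaves fibres of
  cardinality |X|.\<close>

lemma ex_large_fibres: "\<exists>s :: 'a \<Rightarrow> nat \<times> 'a. \<forall>p. large (s -` {p})"
proof -
  have "|UNIV :: nat set| \<le>o |UNIV :: 'a set|"
    using infinite_UNIV infinite_iff_card_of_nat by blast
  then have "|(UNIV :: 'a set) \<times> (UNIV :: nat set)| =o |UNIV :: 'a set|"
    by (intro card_of_Times_infinite[OF infinite_UNIV, THEN conjunct1]) auto
  moreover have "|(UNIV :: 'a set) \<times> ((UNIV :: 'a set) \<times> (UNIV :: nat set))| =o |UNIV :: 'a set|"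
    using calculation
    by (intro card_of_Times_infinite[OF infinite_UNIV, THEN conjunct1]) (auto simp: ordIso_iff_ordLeq)
  ultimately obtain b where b: "bij_betw b (UNIV :: 'a set) (UNIV :: ('a \<times> 'a \<times> nat) set)"
    by (metis UNIV_Times_UNIV card_of_ordIso ordIso_symmetric)
  define s where "s x = (snd (snd (b x)), fst (snd (b x)))" for x
  have "large (s -` {(i, y)})" for i y
  proof -
    have "inj (\<lambda>x. inv b (x, y, i))"
      using b by (auto simp: inj_def bij_betw_def) (metis Pair_inject f_inv_into_f iso_tuple_UNIV_I)
    then have "large (range (\<lambda>x. inv b (x, y, i)))"
      by (intro large_inj_image) auto
    moreover have "range (\<lambda>x. inv b (x, y, i)) \<subseteq> s -` {(i, y)}"
      using b by (auto simp: s_def bij_betw_def f_inv_into_f)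
    ultimately show ?thesis
      using small_mono by blast
  qed
  then show ?thesis by auto
qed

definition \<sigma> :: "'a \<Rightarrow> nat \<times> 'a" where
  "\<sigma> = (SOME s. \<forall>p. large (s -` {p}))"

lemma large_sigma: "large (\<sigma> -` {p})"
  unfolding \<sigma>_def using someI_ex[OF ex_large_fibres] by blast

lemma sigma_surj: "surj \<sigma>"
proof (rule surj_def[THEN iffD2], rule allI)
  fix p
  show "\<exists>x. p = \<sigma> x"
    using large_not_empty[OF large_sigma[of p]] by (metis ex_in_conv vimage_singleton_eq)
qed

lemma large_sigma_vimage: "p \<in> P \<Longrightarrow> large (\<sigma> -` P)"
  using large_sigma[of p] small_mono[of "\<sigma> -` {p}" "\<sigma> -` P"] by auto

lemma split_large:
  assumes "large (A :: 'a set)"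
  obtains A1 A2 where "A = A1 \<union> A2" "A1 \<inter> A2 = {}" "large A1" "large A2"
proof -
  obtain f where f: "bij_betw f (UNIV :: 'a set) A"
    using bij_betw_large[OF large_UNIV assms] .
  define P where "P = \<sigma> -` {p. fst p = 0}"
  have "large P" "large (- P)"
    unfolding P_def vimage_Compl[symmetric]
    by (rule large_sigma_vimage[of "(0, undefined)"], simp)
      (rule large_sigma_vimage[of "(1, undefined)"], simp)
  then have "large (f ` P)" "large (f ` (- P))"
    using f large_inj_image[of P f] large_inj_image[of "- P" f]
    by (auto simp: bij_betw_def inj_def inj_on_def)
  moreover have "A = f ` P \<union> f ` (- P)" "f ` P \<inter> f ` (- P) = {}"
    using f by (auto simp: bij_betw_def inj_def)
  ultimately show thesis using that by blast
qed

lemma ex_half: obtains P where "large (P :: 'a set)" "large (- P)"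
proof -
  obtain A1 A2 :: "'a set" where A: "UNIV = A1 \<union> A2" "A1 \<inter> A2 = {}" "large A1" "large A2"
    using split_large[OF large_UNIV] .
  then have "- A1 = A2" by blast
  with A show thesis using that[of A1] by simp
qed

lemma extend_bij_betw:
  assumes "bij_betw f V W" "large (- V :: 'a set)" "large (- W :: 'a set)"
  shows "\<exists>\<pi>. bij \<pi> \<and> (\<forall>x\<in>V. \<pi> x = f x)"
proof -
  obtain g where g: "bij_betw g (- V) (- W)"
    using bij_betw_large[OF assms(2,3)] .
  have "bij_betw (\<lambda>x. if x \<in> V then f x else g x) (V \<union> - V) (W \<union> - W)"
    using bij_betw_disjoint_Un[OF assms(1) g] by auto
  then show ?thesis
    by (intro exI[of _ "\<lambda>x. if x \<in> V then f x else g x"]) simp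
qed

lemma extend_inj_on:
  assumes "inj_on f V" "large (- V :: 'a set)" "large (- (f ` V) :: 'a set)"
  shows "\<exists>\<pi>. bij \<pi> \<and> (\<forall>x\<in>V. \<pi> x = f x)"
  using extend_bij_betw[OF inj_on_imp_bij_betw[OF assms(1)] assms(2,3)] .

lemma large_surj:
  assumes "large (A :: 'a set)"
  obtains r :: "'a \<Rightarrow> 'a" where "bij_betw r UNIV A"
  using bij_betw_large[OF large_UNIV assms] .

lemma embed_colarge:
  assumes "large (- V :: 'a set)" "large (Y :: 'a set)"
  obtains \<pi> where "bij \<pi>" "\<pi> ` V \<subseteq> Y"
proof -
  \<comment> \<open>Only half of \<open>Y\<close> is used as target; the other half keeps the
    complement of the image large, so that the injection extends to a permutation.\<close>
  obtain A1 A2 where A: "Y = A1 \<union> A2" "A1 \<inter> A2 = {}" "large A1" "large A2"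
    using split_large[OF assms(2)] .
  obtain r :: "'a \<Rightarrow> 'a" where r: "bij_betw r UNIV A1"
    using large_surj[OF A(3)] .
  have "inj_on r V"
    using r by (auto simp: bij_betw_def intro: inj_on_subset)
  moreover have "A2 \<subseteq> - (r ` V)"
    using r A(2) by (auto simp: bij_betw_def)
  then have "large (- (r ` V))"
    using A(4) small_mono by blast
  ultimately obtain \<pi> where \<pi>: "bij \<pi>" "\<And>x. x \<in> V \<Longrightarrow> \<pi> x = r x"
    using extend_inj_on assms(1) by blast
  moreover have "\<pi> ` V \<subseteq> Y"
    using \<pi>(2) r A(1) by (auto simp: bij_betw_def)
  ultimately show thesis using that by blast
qed

text \<open>Over each point of the common range both fibres have cardinality |X|, so they can be
  matched one by one. This transports membership in a monoid containing the permutations.\<close>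

lemma bij_of_large_fibres:
  fixes u v :: "'a \<Rightarrow> 'b"
  assumes "range u = range v"
    and "\<And>x. large (u -` {u x})" "\<And>x. large (v -` {v x})"
  obtains \<pi> where "bij \<pi>" "u = v \<circ> \<pi>"
proof -
  have "\<exists>f. bij_betw f (u -` {z}) (v -` {z})" if "z \<in> range u" for z
  proof -
    obtain x where "z = u x"
      using \<open>z \<in> range u\<close> by blast
    moreover obtain y where "z = v y"
      using \<open>z \<in> range u\<close> unfolding assms(1) by blast
    ultimately have "large (u -` {z})" "large (v -` {z})"
      using assms(2)[of x] assms(3)[of y] by simp_all
    then show ?thesis
      using bij_betw_large by metis
  qed
  then obtain f where f: "\<And>z. z \<in> range u \<Longrightarrow> bij_betw (f z) (u -` {z}) (v -` {z})"
    by metis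
  define \<pi> where "\<pi> x = f (u x) x" for x
  have v\<pi>: "v (\<pi> x) = u x" for x
    using bij_betw_apply[OF f[of "u x"], of x] by (simp add: \<pi>_def)
  have "inj \<pi>"
  proof (rule injI)
    fix x y assume eq: "\<pi> x = \<pi> y"
    then have "u x = u y" using v\<pi> by metis
    with eq f[of "u x"] show "x = y"
      by (auto simp: \<pi>_def bij_betw_def inj_on_def)
  qed
  moreover have "\<exists>x. \<pi> x = y" for y
  proof -
    have r: "v y \<in> range u" by (subst assms(1)) (rule rangeI)
    have "y \<in> f (v y) ` (u -` {v y})"
      using bij_betw_imp_surj_on[OF f[OF r]] by simp
    then obtain x where "x \<in> u -` {v y}" "f (v y) x = y"
      by (metis imageE)
    then have "\<pi> x = y" by (simp add: \<pi>_def)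
    then show ?thesis by (rule exI)
  qed
  ultimately have "bij \<pi>" by (metis bijI surjI surj_def)
  moreover have "u = v \<circ> \<pi>" using v\<pi> by auto
  ultimately show thesis using that by blast
qed

text \<open>Transfinite choice along the cardinal order, whose proper initial segments are small.\<close>

lemma large_nonconflicting_choice:
  fixes T :: "'i \<Rightarrow> 'a set" and e :: "'i \<Rightarrow> 'a" and Q :: "'a \<Rightarrow> 'a \<Rightarrow> bool"
  assumes "inj e" "\<forall>i. large (T i)" "\<forall>x. small {y. Q x y}" "symp Q"
  shows "\<exists>x. (\<forall>i. x i \<in> T i) \<and> (\<forall>i j. i \<noteq> j \<longrightarrow> \<not> Q (x i) (x j))"
proof -
  let ?r = "|UNIV :: 'a set|"
  let ?R = "inv_image (?r - Id) e"
  have wo: "Well_order ?r" "Card_order ?r" "Field ?r = UNIV"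
    by (rule card_of_Well_order, rule card_of_Card_order, rule Field_card_of)
  have wf: "wf ?R"
    using wo(1) by (auto simp: well_order_on_def)
  have seg: "|{j. (j, i) \<in> ?R}| <o ?r" for i
  proof -
    have "e ` {j. (j, i) \<in> ?R} \<subseteq> underS ?r (e i)"
      by (auto simp: underS_def)
    then have "|{j. (j, i) \<in> ?R}| \<le>o |underS ?r (e i)|"
      using card_of_ordLeqI[of e "{j. (j, i) \<in> ?R}" "underS ?r (e i)"] assms(1)
      by (auto intro: inj_on_subset)
    moreover have "|underS ?r (e i)| <o ?r"
      using card_of_underS[OF wo(2), of "e i"] wo(3) by auto
    ultimately show ?thesis using ordLeq_ordLess_trans by blast
  qed
  have "\<exists>x. \<forall>i. x i \<in> T i \<and> (\<forall>j. (j, i) \<in> ?R \<longrightarrow> \<not> Q (x j) (x i))"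
  proof (rule dependent_wf_choice[OF wf])
    fix i and f :: "'i \<Rightarrow> 'a"
    have "small (\<Union>j\<in>{j. (j, i) \<in> ?R}. {y. Q (f j) y})"
      by (rule small_UN_general[OF seg assms(3)[rule_format]])
    then have "T i - (\<Union>j\<in>{j. (j, i) \<in> ?R}. {y. Q (f j) y}) \<noteq> {}"
      using large_not_empty large_Diff assms(2) by blast
    then show "\<exists>r. r \<in> T i \<and> (\<forall>j. (j, i) \<in> ?R \<longrightarrow> \<not> Q (f j) r)"
      by blast
  qed auto
  then obtain x where x: "\<And>i. x i \<in> T i" "\<And>i j. (j, i) \<in> ?R \<Longrightarrow> \<not> Q (x j) (x i)"
    by blast
  have "\<not> Q (x i) (x j)" if "i \<noteq> j" for i j
  proof -
    have "e i \<noteq> e j" using that assms(1) by (auto simp: inj_def)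
    then have "(i, j) \<in> ?R \<or> (j, i) \<in> ?R"
      using wo(1,3) by (auto simp: well_order_on_def linear_order_on_def total_on_def)
    then show ?thesis using x(2) sympD[OF assms(4)] by blast
  qed
  with x(1) show ?thesis by blast
qed

lemma ex_inj_nat_times: obtains e :: "nat \<times> 'a \<Rightarrow> 'a" where "inj e"
  using inj_imp_surj_inv surj_imp_inj_inv[OF sigma_surj] by blast

lemma ex_bij_times: obtains e :: "'a \<times> 'a \<Rightarrow> 'a" where "bij e"
proof -
  have "|(UNIV :: 'a set) \<times> (UNIV :: 'a set)| =o |UNIV :: 'a set|"
    by (rule card_of_Times_same_infinite[OF infinite_UNIV])
  then show thesis
    using that card_of_ordIso[of "UNIV :: ('a \<times> 'a) set" "UNIV :: 'a set"] by auto
qed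

lemma ex_inj_bool_times: obtains e :: "bool \<times> 'a \<Rightarrow> 'a" where "inj e"
proof -
  obtain e :: "nat \<times> 'a \<Rightarrow> 'a" where e: "inj e" using ex_inj_nat_times .
  have "inj (\<lambda>(b, x). e (if b then 1 else 0, x))"
    by (rule injI) (auto dest!: injD[OF e] split: if_splits)
  then show thesis by (rule that)
qed

text \<open>Transfinite choice from the constant family \<open>Y\<close>; adding equality to
  \<open>Q\<close> makes the choice injective, hence its range large.\<close>

lemma thin_large:
  assumes "large (Y :: 'a set)" "\<forall>x. small {y. Q x y}" "symp Q"
  shows "\<exists>R\<subseteq>Y. large R \<and> (\<forall>x\<in>R. \<forall>y\<in>R. x \<noteq> y \<longrightarrow> \<not> Q x y)"
proof -
  have "{y. x = y \<or> Q x y} = {x} \<union> {y. Q x y}" for x by auto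
  then have "\<forall>x. small {y. x = y \<or> Q x y}"
    using small_Un[OF small_finite[of "{x}" for x]] assms(2) by simp
  moreover have "symp (\<lambda>x y. x = y \<or> Q x y)"
    using assms(3) by (auto simp: symp_def)
  ultimately obtain c where c: "\<And>i::'a. c i \<in> Y" "\<And>i j. i \<noteq> j \<Longrightarrow> \<not> (c i = c j \<or> Q (c i) (c j))"
    using large_nonconflicting_choice[of id "\<lambda>_. Y" "\<lambda>x y. x = y \<or> Q x y"] assms(1) by auto
  have "inj c" using c(2) by (auto simp: inj_def)
  then have "large (range c)" by (intro large_inj_image) auto
  moreover have "range c \<subseteq> Y" using c(1) by auto
  moreover have "\<not> Q x y" if "x \<in> range c" "y \<in> range c" "x \<noteq> y" for x y
    using that c(2) by (metis rangeE)
  ultimately show ?thesis by blast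
qed

lemma large_fibre_or_small_fibres:
  fixes w :: "'a \<Rightarrow> 'a"
  assumes "large Y"
  obtains Z where "Z \<subseteq> Y" "large Z" "(\<exists>c. \<forall>x\<in>Z. w x = c) \<or> (\<forall>c. small (w -` {c} \<inter> Z))"
proof (cases "\<exists>c. large (w -` {c} \<inter> Y)")
  case True
  then obtain c where "large (w -` {c} \<inter> Y)" by blast
  then show thesis using that[of "w -` {c} \<inter> Y"] by auto
next
  case False
  then show thesis using that[of Y] assms by auto
qed

end

subsection \<open>Unary parts that break the listed monoids\<close>

text \<open>A list of \<open>n\<close> functions is the same as one map \<open>a\<close> from X to
  X^n. The second form lets later proofs choose the tuples \<open>a x\<close> point by
  point.\<close>

lemma Pol_iff:
  "(n, f) \<in> Pol G \<longleftrightarrow> (n, f) \<in> all_ops \<and>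
    (\<forall>a. (\<forall>x. length (a x) = n) \<and> (\<forall>i<n. (\<lambda>x. a x ! i) \<in> G) \<longrightarrow> (\<lambda>x. f (a x)) \<in> G)"
    (is "?L \<longleftrightarrow> ?O \<and> ?R")
proof (intro iffI conjI allI impI)
  assume L: ?L
  then show ?O by (auto simp: Pol_def)
  fix a assume a: "(\<forall>x. length (a x) = n) \<and> (\<forall>i<n. (\<lambda>x. a x ! i) \<in> G)"
  let ?gs = "map (\<lambda>i x. a x ! i) [0..<n]"
  have "length ?gs = n \<and> set ?gs \<subseteq> G" using a by auto
  then have "(\<lambda>x. f (map (\<lambda>g. g x) ?gs)) \<in> G"
    using L unfolding Pol_def by blast
  moreover have "map (\<lambda>g. g x) ?gs = a x" for x
    using a by (intro nth_equalityI) auto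
  ultimately show "(\<lambda>x. f (a x)) \<in> G" by simp
next
  assume R: "?O \<and> ?R"
  have "(\<lambda>x. f (map (\<lambda>g. g x) gs)) \<in> G" if "length gs = n" "set gs \<subseteq> G" for gs
    using R that by (auto simp: subset_iff)
  with R show ?L by (auto simp: Pol_def)
qed

text \<open>Usually described by a map F from X to small sets with f(x) in F(x_k); here F is taken
  to be the least such map.\<close>

definition almost_unary :: "'a operation set" where
  "almost_unary = {(n, f) \<in> all_ops. \<exists>k<n. \<forall>c. small (f ` {xs \<in> tuples n. xs ! k = c})}"

text \<open>The complement of \<open>monoid_B\<close>. On an infinite X it omits the identity, so
  \<open>Pol large_fibre\<close> is free to contain every unary operation, and it does.\<close>

definition large_fibre :: "('a \<Rightarrow> 'a) set" where
  "large_fibre = {f. \<exists>c. large (f -` {c})}"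

text \<open>\<open>M\<close> stands for the unary part of a clone \<open>C\<close>; the clone laws
  appear only through the closure of \<open>M\<close> under \<open>C\<close> and under
  composition.\<close>

locale perm_monoid = regular_universe ty for ty :: "'a itself" +
  fixes C :: "'a operation set" and M :: "('a \<Rightarrow> 'a) set"
  assumes C_ops: "C \<subseteq> all_ops"
    and C_Pol: "C \<subseteq> Pol M"
    and M_comp: "f \<in> M \<Longrightarrow> g \<in> M \<Longrightarrow> f \<circ> g \<in> M"
    and M_bij: "bij f \<Longrightarrow> f \<in> M"
begin

lemma C_arity: "(n, f) \<in> C \<Longrightarrow> n \<ge> 1"
  using C_ops by (auto simp: all_ops_def)

lemma C_apply:
  assumes "(n, f) \<in> C" "\<And>x. length (a x) = n" "\<And>i. i < n \<Longrightarrow> (\<lambda>x. a x ! i) \<in> M"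
  shows "(\<lambda>x. f (a x)) \<in> M"
  using assms C_Pol Pol_iff[of n f M] by blast

lemma C_break:
  assumes "\<not> C \<subseteq> Pol G"
  shows "\<exists>n f a. (n, f) \<in> C \<and> 1 \<le> n \<and> (\<forall>x. length (a x) = n) \<and>
    (\<forall>i<n. (\<lambda>x. a x ! i) \<in> G) \<and> (\<lambda>x. f (a x)) \<notin> G"
proof -
  obtain n f where nf: "(n, f) \<in> C" "(n, f) \<notin> Pol G"
    using assms by auto
  then have "(n, f) \<in> all_ops" using C_ops by blast
  then show ?thesis
    using nf C_arity Pol_iff[of n f G] by blast
qed

text \<open>Replace each component of the witness \<open>a\<close> by the member of \<open>M\<close>
  that agrees with it on \<open>V\<close>, and apply \<open>f\<close>. This turns a failure of some
  \<open>Pol G\<close> into a member of \<open>M\<close> that shows the failure on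
  \<open>V\<close>.\<close>

lemma C_transfer:
  assumes "(n, f) \<in> C" "\<forall>x. length (a x) = n"
    and "\<forall>i<n. \<exists>m\<in>M. \<forall>x\<in>V. m x = a x ! i"
  shows "\<exists>h\<in>M. \<forall>x\<in>V. h x = f (a x)"
proof -
  obtain m where m: "\<And>i. i < n \<Longrightarrow> m i \<in> M" "\<And>i x. i < n \<Longrightarrow> x \<in> V \<Longrightarrow> m i x = a x ! i"
    using assms(3) by metis
  define b where "b x = map (\<lambda>i. m i x) [0..<n]" for x
  have "(\<lambda>x. f (b x)) \<in> M"
  proof (rule C_apply[OF assms(1)])
    fix i assume "i < n"
    then have "(\<lambda>x. b x ! i) = m i" by (auto simp: b_def)
    with m(1) \<open>i < n\<close> show "(\<lambda>x. b x ! i) \<in> M" by simp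
  qed (simp add: b_def)
  moreover have "b x = a x" if "x \<in> V" for x
    using that m(2) assms(2) by (intro nth_equalityI) (auto simp: b_def)
  ultimately show ?thesis by metis
qed

text \<open>A violation of \<open>monoid_B\<close> is a large fibre of \<open>f\<close> applied to
  components with small fibres. Thinned until all components are injective, it is reproduced with
  permutations as components.\<close>

lemma M_large_fibre:
  assumes "\<not> C \<subseteq> Pol monoid_B"
  obtains h c where "h \<in> M" "large (h -` {c})"
proof -
  obtain n f a where f: "(n, f) \<in> C" "1 \<le> n" "\<And>x. length (a x) = n"
    "\<And>i. i < n \<Longrightarrow> (\<lambda>x. a x ! i) \<in> monoid_B" "(\<lambda>x. f (a x)) \<notin> monoid_B"
    using C_break[OF assms] by blast
  then obtain c where c: "large {x. f (a x) = c}"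
    by (auto simp: monoid_B_def vimage_def)
  \<comment> \<open>A point conflicts with the points that share one of its finitely many entries;
    as the fibres are small, these are few.\<close>
  define Q where "Q x y \<longleftrightarrow> (\<exists>i<n. a x ! i = a y ! i)" for x y
  have "{y. Q x y} = (\<Union>i\<in>{..<n}. (\<lambda>x. a x ! i) -` {a x ! i})" for x
    by (auto simp: Q_def)
  then have Q: "\<forall>x. small {y. Q x y}"
    using f(4) by (auto intro!: small_UN_finite simp: monoid_B_def)
  have "symp Q"
    unfolding Q_def symp_def by metis
  from thin_large[OF c Q this]
  obtain R where R: "R \<subseteq> {x. f (a x) = c}" "large R"
    "\<forall>x\<in>R. \<forall>y\<in>R. x \<noteq> y \<longrightarrow> \<not> Q x y"
    by auto
  \<comment> \<open>\<open>R2\<close> is sacrificed to keep the complement of \<open>R1\<close>, and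
    of its image under each component, large.\<close>
  obtain R1 R2 where R12: "R = R1 \<union> R2" "R1 \<inter> R2 = {}" "large R1" "large R2"
    using split_large[OF R(2)] .
  have "\<exists>m\<in>M. \<forall>x\<in>R1. m x = a x ! i" if "i < n" for i
  proof -
    have inj: "inj_on (\<lambda>x. a x ! i) R"
      using R(3) that unfolding Q_def inj_on_def by blast
    have "(\<lambda>x. a x ! i) ` R2 \<subseteq> - ((\<lambda>x. a x ! i) ` R1)"
      using inj R12(1,2) by (auto simp: inj_on_def)
    moreover have "inj_on (\<lambda>x. a x ! i) R2" "inj_on (\<lambda>x. a x ! i) R1"
      using inj R12(1) by (auto simp: inj_on_def)
    ultimately have "large (- ((\<lambda>x. a x ! i) ` R1))"
      using large_inj_image[OF R12(4)] small_mono by blast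
    moreover have "large (- R1)"
      using R12(2,4) small_mono[of R2 "- R1"] by blast
    ultimately obtain \<pi> where "bij \<pi>" "\<And>x. x \<in> R1 \<Longrightarrow> \<pi> x = a x ! i"
      using extend_inj_on[OF \<open>inj_on (\<lambda>x. a x ! i) R1\<close>] by blast
    then show ?thesis using M_bij by blast
  qed
  then obtain h where h: "h \<in> M" "\<And>x. x \<in> R1 \<Longrightarrow> h x = f (a x)"
    using C_transfer[OF f(1), of a R1] f(3) by blast
  have "R1 \<subseteq> h -` {c}"
    using R(1) R12(1) h(2) by auto
  then have "large (h -` {c})"
    using R12(3) small_mono by blast
  with h(1) that show thesis by blast
qed

text \<open>A permutation squeezes \<open>V\<close> into a large fibre of one member of
  \<open>M\<close>, and a transposition corrects the value.\<close>

lemma M_constant_on: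
  assumes "\<not> C \<subseteq> Pol monoid_B" "large (- V :: 'a set)"
  shows "\<exists>m\<in>M. \<forall>x\<in>V. m x = b"
proof -
  obtain h c where h: "h \<in> M" "large (h -` {c})"
    using M_large_fibre[OF assms(1)] .
  obtain \<pi> where \<pi>: "bij \<pi>" "\<pi> ` V \<subseteq> h -` {c}"
    using embed_colarge[OF assms(2) h(2)] .
  let ?\<tau> = "\<lambda>x. if x = c then b else if x = b then c else x"
  have "bij ?\<tau>"
    by (rule o_bij[of ?\<tau>]) auto
  then have "?\<tau> \<circ> (h \<circ> \<pi>) \<in> M"
    using h(1) \<pi>(1) M_comp M_bij by simp
  moreover have "(?\<tau> \<circ> (h \<circ> \<pi>)) x = b" if "x \<in> V" for x
    using that \<pi>(2) by (auto simp: image_subset_iff)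
  ultimately show ?thesis by blast
qed

end

section \<open>Many large fibres and the extension of partial functions\<close>

context regular_universe
begin

text \<open>With \<open>W = UNIV\<close> this is the negation of \<open>h \<in> monoid_A\<close>;
  the relative form can be passed down to subsets.\<close>

definition many_fibres :: "('a \<Rightarrow> 'a) \<Rightarrow> 'a set \<Rightarrow> bool" where
  "many_fibres h W \<longleftrightarrow> large {y. large (h -` {y} \<inter> W)}"

text \<open>The small set of bad values of \<open>g\<close> cuts \<open>W\<close> into few pieces:
  one where \<open>g\<close> has small fibres, and one for each bad value, where \<open>g\<close> is
  constant. By regularity each large fibre of \<open>h\<close> stays large in some piece, and some
  single piece retains many of them.\<close>

lemma many_fibres_shrink:
  assumes "many_fibres h W" "g \<in> monoid_A"
  obtains W' where "W' \<subseteq> W" "many_fibres h W'"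
    "(\<exists>c. \<forall>x\<in>W'. g x = c) \<or> (\<forall>c. small (g -` {c} \<inter> W'))"
proof -
  let ?bad = "{v. large (g -` {v})}"
  let ?Z = "\<lambda>W. {y. large (h -` {y} \<inter> W)}"
  have bad: "small ?bad"
    using assms(2) by (simp add: monoid_A_def almost_all_def)
  have "y \<in> ?Z (W - g -` ?bad) \<union> (\<Union>v\<in>?bad. ?Z (W \<inter> g -` {v}))" if y: "y \<in> ?Z W" for y
  proof (rule ccontr)
    assume "\<not> ?thesis"
    then have "small (h -` {y} \<inter> (W - g -` ?bad) \<union> (\<Union>v\<in>?bad. h -` {y} \<inter> (W \<inter> g -` {v})))"
      by (intro small_Un small_UN bad) auto
    moreover have "h -` {y} \<inter> W =
        h -` {y} \<inter> (W - g -` ?bad) \<union> (\<Union>v\<in>?bad. h -` {y} \<inter> (W \<inter> g -` {v}))"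
      by auto
    ultimately show False using y by simp
  qed
  then have "?Z W \<subseteq> ?Z (W - g -` ?bad) \<union> (\<Union>v\<in>?bad. ?Z (W \<inter> g -` {v}))"
    by (rule subsetI)
  then have "large (?Z (W - g -` ?bad) \<union> (\<Union>v\<in>?bad. ?Z (W \<inter> g -` {v})))"
    using assms(1) small_mono[of "?Z W"] unfolding many_fibres_def by metis
  then consider "many_fibres h (W - g -` ?bad)" | v where "many_fibres h (W \<inter> g -` {v})"
    unfolding many_fibres_def small_Un_iff
    using small_UN[OF bad, of "\<lambda>v. ?Z (W \<inter> g -` {v})"] by metis
  then show thesis
  proof cases
    case 1
    have "small (g -` {c} \<inter> (W - g -` ?bad))" for c
      by (cases "c \<in> ?bad") (auto intro: small_mono[of _ "g -` {c}"] small_mono[of _ "{}"] small_finite)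
    with 1 that[of "W - g -` ?bad"] show thesis by auto
  next
    case 2
    with that[of "W \<inter> g -` {v}"] show thesis by auto
  qed
qed

lemma many_fibres_shrink_list:
  fixes a :: "'a \<Rightarrow> 'a list"
  assumes "many_fibres h UNIV" "\<And>i. i < n \<Longrightarrow> (\<lambda>x. a x ! i) \<in> monoid_A"
  shows "\<exists>W. many_fibres h W \<and>
    (\<forall>i<n. (\<exists>c. \<forall>x\<in>W. a x ! i = c) \<or> (\<forall>c. small ((\<lambda>x. a x ! i) -` {c} \<inter> W)))"
  using assms(2)
proof (induction n)
  case 0
  with assms(1) show ?case by auto
next
  case (Suc n)
  then obtain W where W: "many_fibres h W"
    "\<forall>i<n. (\<exists>c. \<forall>x\<in>W. a x ! i = c) \<or> (\<forall>c. small ((\<lambda>x. a x ! i) -` {c} \<inter> W))"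
    by (metis less_SucI)
  obtain W' where W': "W' \<subseteq> W" "many_fibres h W'"
    "(\<exists>c. \<forall>x\<in>W'. a x ! n = c) \<or> (\<forall>c. small ((\<lambda>x. a x ! n) -` {c} \<inter> W'))"
    using many_fibres_shrink[OF W(1) Suc.prems[of n]] by auto
  have "(\<exists>c. \<forall>x\<in>W'. a x ! i = c) \<or> (\<forall>c. small ((\<lambda>x. a x ! i) -` {c} \<inter> W'))" if "i < n" for i
  proof -
    have "(\<lambda>x. a x ! i) -` {c} \<inter> W' \<subseteq> (\<lambda>x. a x ! i) -` {c} \<inter> W" for c
      using W'(1) by auto
    then show ?thesis
      using W(2) that W'(1) small_mono by (meson subsetD)
  qed
  with W' show ?case by (auto simp: less_Suc_eq intro!: exI[of _ W'])
qed

end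

context perm_monoid
begin

text \<open>After shrinking, each component is constant or has small fibres on \<open>W\<close>. The
  constant ones come from \<open>M_constant_on\<close>, the others are thinned to injective ones and
  come from permutations.\<close>

lemma M_many_large_fibres:
  assumes "\<not> C \<subseteq> Pol monoid_A" "\<not> C \<subseteq> Pol monoid_B"
  obtains h where "h \<in> M" "large {y. large (h -` {y})}"
proof -
  obtain n f a where f: "(n, f) \<in> C" "1 \<le> n" "\<And>x. length (a x) = n"
    "\<And>i. i < n \<Longrightarrow> (\<lambda>x. a x ! i) \<in> monoid_A" "(\<lambda>x. f (a x)) \<notin> monoid_A"
    using C_break[OF assms(1)] by blast
  let ?h = "\<lambda>x. f (a x)"
  have "many_fibres ?h UNIV"
    using f(5) by (simp add: many_fibres_def monoid_A_def almost_all_def)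
  then obtain W where W: "many_fibres ?h W"
    "\<forall>i<n. (\<exists>c. \<forall>x\<in>W. a x ! i = c) \<or> (\<forall>c. small ((\<lambda>x. a x ! i) -` {c} \<inter> W))"
    using many_fibres_shrink_list[of ?h n a] f(4) by blast
  let ?I = "{i. i < n \<and> (\<forall>c. small ((\<lambda>x. a x ! i) -` {c} \<inter> W))}"
  obtain z :: "'a \<Rightarrow> 'a" where z: "bij_betw z UNIV {y. large (?h -` {y} \<inter> W)}"
    using large_surj W(1) unfolding many_fibres_def by blast
  obtain e :: "'a \<times> 'a \<Rightarrow> 'a" where e: "bij e" using ex_bij_times .
  define Q where "Q x y \<longleftrightarrow> x = y \<or> (x \<in> W \<and> y \<in> W \<and> (\<exists>i\<in>?I. a x ! i = a y ! i))" for x y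
  have "{y. Q x y} \<subseteq> {x} \<union> (\<Union>i\<in>?I. (\<lambda>x. a x ! i) -` {a x ! i} \<inter> W)" for x
    by (auto simp: Q_def)
  moreover have "small ({x} \<union> (\<Union>i\<in>?I. (\<lambda>x. a x ! i) -` {a x ! i} \<inter> W))" for x
    by (intro small_Un small_UN_finite) (auto intro: small_finite)
  ultimately have Q: "\<forall>x. small {y. Q x y}"
    using small_mono by blast
  have T: "\<forall>p :: 'a \<times> 'a. large (?h -` {z (fst p)} \<inter> W)"
    using z by (auto simp: bij_betw_def)
  have "symp Q"
    by (rule sympI) (auto simp: Q_def)
  \<comment> \<open>For fixed \<open>u\<close> the points \<open>s (u, v)\<close> form a large part
    of the fibre over \<open>z u\<close>, and each component in \<open>?I\<close> is injective along
    \<open>s\<close>.\<close>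
  from large_nonconflicting_choice[OF bij_is_inj[OF e] T Q this]
  obtain s where s: "\<forall>p :: 'a \<times> 'a. s p \<in> ?h -` {z (fst p)} \<inter> W" "\<forall>p q. p \<noteq> q \<longrightarrow> \<not> Q (s p) (s q)"
    by (elim exE conjE) (rule that)
  have s_inj: "inj s" using s(2) by (auto simp: Q_def inj_def)
  \<comment> \<open>Only the fibres indexed by \<open>P\<close> are kept; the points chosen in the
    others make the complements of \<open>V\<close> and of its images large.\<close>
  obtain P :: "'a set" where P: "large P" "large (- P)" using ex_half .
  define V where "V = s ` (P \<times> UNIV)"
  have "inj (\<lambda>u. s (u, undefined))" by (rule injI) (drule injD[OF s_inj], simp)
  then have "large ((\<lambda>u. s (u, undefined)) ` (- P))"
    using large_inj_image[OF P(2)] inj_on_subset[OF _ subset_UNIV] by blast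
  moreover have "(\<lambda>u. s (u, undefined)) ` (- P) \<subseteq> - V"
    by (auto simp: V_def dest: injD[OF s_inj])
  ultimately have coV: "large (- V)" using small_mono by blast
  have "\<exists>m\<in>M. \<forall>x\<in>V. m x = a x ! i" if i: "i < n" for i
  proof (cases "i \<in> ?I")
    case True
    have inj: "inj (\<lambda>p. a (s p) ! i)"
      using s True unfolding Q_def inj_def by blast
    have "inj (\<lambda>u. a (s (u, undefined)) ! i)" by (rule injI) (drule injD[OF inj], simp)
    then have "large ((\<lambda>u. a (s (u, undefined)) ! i) ` (- P))"
      using large_inj_image[OF P(2)] inj_on_subset[OF _ subset_UNIV] by blast
    moreover have "(\<lambda>u. a (s (u, undefined)) ! i) ` (- P) \<subseteq> - ((\<lambda>x. a x ! i) ` V)"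
      by (auto simp: V_def dest: injD[OF inj])
    ultimately have "large (- ((\<lambda>x. a x ! i) ` V))" using small_mono by blast
    moreover have "inj_on (\<lambda>x. a x ! i) V"
      by (auto simp: V_def intro!: inj_onI dest: injD[OF inj])
    ultimately obtain \<pi> where "bij \<pi>" "\<And>x. x \<in> V \<Longrightarrow> \<pi> x = a x ! i"
      using extend_inj_on coV by blast
    then show ?thesis using M_bij by blast
  next
    case False
    then obtain c where "\<forall>x\<in>W. a x ! i = c" using W(2) i by blast
    moreover have "V \<subseteq> W" using s(1) by (auto simp: V_def)
    ultimately show ?thesis using M_constant_on[OF assms(2) coV, of c] by (metis subsetD)
  qed
  then obtain h where h: "h \<in> M" "\<And>x. x \<in> V \<Longrightarrow> h x = f (a x)"
    using C_transfer[OF f(1), of a V] f(3) by blast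
  have "large (h -` {z u})" if "u \<in> P" for u
  proof -
    have "inj (\<lambda>v. s (u, v))" by (rule injI) (drule injD[OF s_inj], simp)
    then have "large (range (\<lambda>v. s (u, v)))" by (intro large_inj_image) auto
    moreover have "range (\<lambda>v. s (u, v)) \<subseteq> h -` {z u}"
    proof (intro image_subsetI)
      fix v
      have "s (u, v) \<in> V" using that by (auto simp: V_def)
      with h(2) s(1)[rule_format, of "(u, v)"] show "s (u, v) \<in> h -` {z u}" by simp
    qed
    ultimately show ?thesis using small_mono by blast
  qed
  then have "z ` P \<subseteq> {y. large (h -` {y})}" by auto
  moreover have "large (z ` P)"
    by (rule large_inj_image[OF P(1) inj_on_subset[OF bij_betw_imp_inj_on[OF z] subset_UNIV]])
  ultimately have "large {y. large (h -` {y})}"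
    using small_mono by blast
  with h(1) that show thesis by blast
qed

text \<open>\<open>\<tau>\<close> moves the values of \<open>k\<close> to points over which
  \<open>h\<close> has large fibres. An injective choice of preimages then extends to a permutation
  \<open>\<pi>\<close>, and \<open>h \<circ> \<pi>\<close> is \<open>k\<close> up to renaming
  values.\<close>

lemma M_extend_colarge:
  assumes A: "\<not> C \<subseteq> Pol monoid_A" and B: "\<not> C \<subseteq> Pol monoid_B"
    and V: "large (- V :: 'a set)" "large (- (k ` V) :: 'a set)"
  shows "\<exists>m\<in>M. \<forall>x\<in>V. m x = k x"
proof -
  obtain h where h: "h \<in> M" "large {y. large (h -` {y})}"
    using M_many_large_fibres[OF A B] .
  obtain \<tau> where \<tau>: "bij \<tau>" "\<tau> ` k ` V \<subseteq> {y. large (h -` {y})}"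
    using embed_colarge[OF V(2) h(2)] .
  \<comment> \<open>The indices with \<open>False\<close> are placeholders: their points stay
    outside the image of the section and make its complement large.\<close>
  define T where "T = (\<lambda>(b, x). if b \<and> x \<in> V then h -` {\<tau> (k x)} else UNIV)"
  have T: "\<forall>p. large (T p)"
    using \<tau>(2) by (auto simp: T_def split: prod.split)
  obtain e :: "bool \<times> 'a \<Rightarrow> 'a" where e: "inj e" using ex_inj_bool_times .
  have "\<forall>x :: 'a. small {y. x = y}"
    by (auto intro: small_finite)
  from large_nonconflicting_choice[OF e T this symp_on_equality]
  obtain s where s: "\<forall>p. s p \<in> T p" "\<forall>p q. p \<noteq> q \<longrightarrow> s p \<noteq> s q"
    by auto
  have "inj s" using s(2) by (metis injI)
  note sD = injD[OF this]
  have "inj_on (\<lambda>x. s (True, x)) V" "inj (\<lambda>x. s (False, x))"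
    by (auto intro!: inj_onI dest: sD)
  moreover have "range (\<lambda>x. s (False, x)) \<subseteq> - ((\<lambda>x. s (True, x)) ` V)"
    by (auto dest: sD)
  ultimately have "large (- ((\<lambda>x. s (True, x)) ` V))"
    using large_inj_image[OF large_UNIV] small_mono by blast
  then obtain \<pi> where \<pi>: "bij \<pi>" "\<And>x. x \<in> V \<Longrightarrow> \<pi> x = s (True, x)"
    using extend_inj_on[OF \<open>inj_on (\<lambda>x. s (True, x)) V\<close> V(1)] by blast
  have "h (\<pi> x) = \<tau> (k x)" if "x \<in> V" for x
    using s(1)[rule_format, of "(True, x)"] that \<pi>(2) by (simp add: T_def)
  then have "(inv \<tau> \<circ> (h \<circ> \<pi>)) x = k x" if "x \<in> V" for x
    using that \<tau>(1) by (simp add: bij_is_inj)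
  moreover have "inv \<tau> \<circ> (h \<circ> \<pi>) \<in> M"
    using h(1) \<pi>(1) \<tau>(1) M_comp M_bij bij_imp_bij_inv by blast
  ultimately show ?thesis by blast
qed

text \<open>For the index |X| the components miss many points on \<open>- D\<close>, so
  \<open>M_extend_colarge\<close> provides them, whereas the result of \<open>f\<close> misses
  few.\<close>

lemma M_almost_onto:
  assumes A: "\<not> C \<subseteq> Pol monoid_A" and B: "\<not> C \<subseteq> Pol monoid_B"
    and G: "\<not> C \<subseteq> Pol (monoid_G |UNIV :: 'a set| )"
  obtains s V where "s \<in> M" "large (- V)" "small (- (s ` V))"
proof -
  obtain n f a where f: "(n, f) \<in> C" "1 \<le> n" "\<And>x. length (a x) = n"
    "\<And>i. i < n \<Longrightarrow> (\<lambda>x. a x ! i) \<in> monoid_G |UNIV :: 'a set|"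
    "(\<lambda>x. f (a x)) \<notin> monoid_G |UNIV :: 'a set|"
    using C_break[OF G] by blast
  obtain D :: "'a set" where D: "large D" "small (- ((\<lambda>x. f (a x)) ` (- D)))"
    using f(5) by (auto simp: monoid_G_def large_iff_ordIso[symmetric] large_iff[symmetric]
        Compl_eq_Diff_UNIV)
  have "\<exists>m\<in>M. \<forall>x\<in>- D. m x = a x ! i" if "i < n" for i
    using M_extend_colarge[OF A B, of "- D" "\<lambda>x. a x ! i"] f(4)[OF that] D(1)
    by (auto simp: monoid_G_def large_iff_ordIso[symmetric] large_iff[symmetric]
        Compl_eq_Diff_UNIV double_diff)
  then obtain h where h: "h \<in> M" "\<And>x. x \<in> - D \<Longrightarrow> h x = f (a x)"
    using C_transfer[OF f(1), of a "- D"] f(3) by blast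
  have "h ` (- D) = (\<lambda>x. f (a x)) ` (- D)"
    using h(2) by (intro image_cong) auto
  with D h(1) that[of h "- D"] show thesis by simp
qed

text \<open>If \<open>k\<close> misses at least as many values as \<open>s\<close> does on
  \<open>W\<close>, a permutation \<open>\<tau>\<close> carries some of them onto the points missed
  by \<open>s\<close>. Then \<open>\<tau> \<circ> k\<close> lifts through \<open>s\<close> to a map
  into \<open>W\<close>, which has a large co-image and extends by
  \<open>M_extend_colarge\<close>.\<close>

lemma M_extend_deficient:
  assumes A: "\<not> C \<subseteq> Pol monoid_A" and B: "\<not> C \<subseteq> Pol monoid_B"
    and s: "s \<in> M" "large (- W)" "small (- (s ` W))"
    and V: "large (- V)" "|- (s ` W)| \<le>o |- (k ` V) :: 'a set|"
  shows "\<exists>m\<in>M. \<forall>x\<in>V. m x = k x"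
proof -
  obtain N where N: "N \<subseteq> - (k ` V)" "|N| =o |- (s ` W)|"
    using V(2) internalize_card_of_ordLeq2 ordIso_symmetric by metis
  then obtain g where g: "bij_betw g N (- (s ` W))"
    using card_of_ordIso by blast
  have "small N"
    using N(2) s(3) ordIso_ordLess_trans unfolding small_def by blast
  then obtain \<tau> where \<tau>: "bij \<tau>" "\<And>x. x \<in> N \<Longrightarrow> \<tau> x = g x"
    using extend_bij_betw[OF g] large_Compl_small s(3) by blast
  have \<tau>N: "\<tau> ` N = - (s ` W)"
    using g \<tau>(2) by (auto simp: bij_betw_def)
  have "\<tau> (k x) \<in> s ` W" if "x \<in> V" for x
  proof (rule ccontr)
    assume "\<tau> (k x) \<notin> s ` W"
    then have "\<tau> (k x) \<in> \<tau> ` N" using \<tau>N by simp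
    then have "k x \<in> N" using \<tau>(1) by (auto simp: bij_def inj_def)
    then show False using N(1) that by blast
  qed
  then have "\<forall>x\<in>V. \<exists>w. w \<in> W \<and> s w = \<tau> (k x)"
    unfolding image_iff by metis
  then obtain q where q: "\<And>x. x \<in> V \<Longrightarrow> q x \<in> W \<and> s (q x) = \<tau> (k x)"
    by metis
  have "- W \<subseteq> - (q ` V)" using q by auto
  then have "large (- (q ` V))" using s(2) small_mono by blast
  then obtain m where m: "m \<in> M" "\<And>x. x \<in> V \<Longrightarrow> m x = q x"
    using M_extend_colarge[OF A B V(1)] by blast
  have "inv \<tau> \<circ> (s \<circ> m) \<in> M"
    using s(1) m(1) \<tau>(1) M_comp M_bij bij_imp_bij_inv by blast
  moreover have "(inv \<tau> \<circ> (s \<circ> m)) x = k x" if "x \<in> V" for x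
    using that m(2) q \<tau>(1) by (simp add: bij_is_inj)
  ultimately show ?thesis by blast
qed

text \<open>Among the members of \<open>M\<close> that are almost onto on a set with large complement, one missing
  as few points as possible misses none, since otherwise breaking the monoid indexed by the number
  of missing points would yield a better one.\<close>

lemma M_extend:
  assumes A: "\<not> C \<subseteq> Pol monoid_A" and B: "\<not> C \<subseteq> Pol monoid_B"
    and G: "\<And>l. Card_order l \<Longrightarrow> cone \<le>o l \<Longrightarrow> l \<le>o |UNIV :: 'a set| \<Longrightarrow> \<not> C \<subseteq> Pol (monoid_G l)"
    and V: "large (- V)"
  shows "\<exists>m\<in>M. \<forall>x\<in>V. m x = k x"
proof -
  let ?S = "{|- (s ` W)| | s W. s \<in> M \<and> large (- W)}"
  have cone: "cone \<le>o |N|" if "N \<noteq> {}" for N :: "'a set"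
    using that unfolding cone_def by (metis card_of_ordLeq2 singleton_iff card_of_singl_ordLeq)
  have card: "\<forall>r\<in>?S. Card_order r" by (auto simp: card_of_Card_order)
  obtain s0 W0 where s0: "s0 \<in> M" "large (- W0)" "small (- (s0 ` W0))"
    using M_almost_onto[OF A B] G[OF card_of_Card_order cone card_of_mono1, of UNIV] by blast
  then have "?S \<noteq> {}" by blast
  then obtain r where "r \<in> ?S" "\<forall>r'\<in>?S. r \<le>o r'"
    using exists_minim_Card_order[OF _ card] by blast
  then obtain s W where s: "s \<in> M" "large (- W)"
    "\<And>s' W'. s' \<in> M \<Longrightarrow> large (- W') \<Longrightarrow> |- (s ` W)| \<le>o |- (s' ` W')|"
    by blast
  have small: "small (- (s ` W))"
    using s(3)[OF s0(1,2)] s0(3) ordLeq_ordLess_trans unfolding small_def by blast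
  have "- (s ` W) = {}"
  proof (rule ccontr)
    let ?l = "|- (s ` W)|"
    assume "- (s ` W) \<noteq> {}"
    then have "\<not> C \<subseteq> Pol (monoid_G ?l)"
      by (intro G card_of_Card_order cone card_of_mono1) auto
    then obtain n f a where f: "(n, f) \<in> C" "1 \<le> n" "\<And>x. length (a x) = n"
      "\<And>i. i < n \<Longrightarrow> (\<lambda>x. a x ! i) \<in> monoid_G ?l" "(\<lambda>x. f (a x)) \<notin> monoid_G ?l"
      using C_break by blast
    obtain D :: "'a set" where D: "|D| =o ?l" "\<not> ?l \<le>o |- ((\<lambda>x. f (a x)) ` (- D))|"
      using f(5) by (auto simp: monoid_G_def Compl_eq_Diff_UNIV)
    have "small D"
      using D(1) small ordIso_ordLess_trans unfolding small_def by blast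
    then have lD: "large (- D)" by (rule large_Compl_small)
    \<comment> \<open>The complement of \<open>- D\<close> is small, so the arguments are moved by
      \<open>r\<close> to a set \<open>P\<close> with large complement before extending.\<close>
    obtain P :: "'a set" where P: "large P" "large (- P)" using ex_half .
    obtain r where r: "bij_betw r P (- D)" using bij_betw_large[OF P(1) lD] .
    have "\<exists>m\<in>M. \<forall>x\<in>P. m x = a (r x) ! i" if "i < n" for i
    proof (rule M_extend_deficient[OF A B s(1,2) small P(2)])
      have "(\<lambda>x. a (r x) ! i) ` P = (\<lambda>x. a x ! i) ` (- D)"
        by (simp add: bij_betw_imp_surj_on[OF r, symmetric] image_image)
      then show "?l \<le>o |- ((\<lambda>x. a (r x) ! i) ` P)|"
        using f(4)[OF that] D(1) by (simp add: monoid_G_def Compl_eq_Diff_UNIV)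
    qed
    then obtain h where h: "h \<in> M" "\<And>x. x \<in> P \<Longrightarrow> h x = f (a (r x))"
      using C_transfer[OF f(1), of "\<lambda>x. a (r x)" P] f(3) by blast
    have "h ` P = (\<lambda>x. f (a x)) ` (- D)"
      using r h(2) by (force simp: bij_betw_def)
    with s(3)[OF h(1) P(2)] D(2) show False by simp
  qed
  then show ?thesis
    using M_extend_deficient[OF A B s(1,2) small V] by (metis card_of_empty)
qed

end

subsection \<open>Unary parts with the extension property\<close>

context regular_universe
begin

lemma range_comp_sigma: "range (\<lambda>x. \<phi> (\<sigma> x)) = range \<phi>"
proof -
  have "range (\<lambda>x. \<phi> (\<sigma> x)) = \<phi> ` range \<sigma>" by (simp add: image_image)
  then show ?thesis using sigma_surj by simp
qed

lemma large_fibres_comp_sigma: "large ((\<lambda>x. \<phi> (\<sigma> x)) -` {\<phi> (\<sigma> x)})"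
proof -
  have "\<sigma> -` {\<sigma> x} \<subseteq> (\<lambda>x. \<phi> (\<sigma> x)) -` {\<phi> (\<sigma> x)}" by auto
  then show ?thesis using large_sigma small_mono by blast
qed

end

locale extending_monoid = perm_monoid ty C M for ty :: "'a itself" and C M +
  assumes extend: "large (- V :: 'a set) \<Longrightarrow> \<exists>m\<in>M. \<forall>x\<in>V. m x = k x"
begin

text \<open>The extension property is applied to \<open>k\<close> on the range of
  \<open>h\<close>.\<close>

lemma M_comp_of_colarge:
  assumes "h \<in> M" "large (- range h)"
  shows "(\<lambda>x. k (h x)) \<in> M"
proof -
  obtain m where m: "m \<in> M" "\<And>x. x \<in> range h \<Longrightarrow> m x = k x"
    using extend[OF assms(2)] by blast
  have "(\<lambda>x. k (h x)) = m \<circ> h" using m(2) by auto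
  with m(1) assms(1) M_comp show ?thesis by simp
qed

text \<open>A partial surjection with large fibres extends to a member of \<open>M\<close>, and the
  uncontrolled values off \<open>P\<close> can only enlarge its fibres. All surjections with only
  large fibres agree with it up to a permutation.\<close>

lemma M_surj_sigma:
  fixes \<phi> :: "nat \<times> 'a \<Rightarrow> 'a"
  assumes "surj \<phi>"
  shows "(\<lambda>x. \<phi> (\<sigma> x)) \<in> M"
proof -
  obtain P :: "'a set" where P: "large P" "large (- P)" using ex_half .
  obtain r where r: "bij_betw r (UNIV :: 'a set) P" using large_surj[OF P(1)] .
  obtain m where m: "m \<in> M" "\<And>x. x \<in> P \<Longrightarrow> m x = snd (\<sigma> (inv r x))"
    using extend[OF P(2), of "\<lambda>x. snd (\<sigma> (inv r x))"] by blast
  have mr: "m (r x) = snd (\<sigma> x)" for x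
    using m(2)[of "r x"] r by (auto simp: bij_betw_def)
  have fib: "large (m -` {y})" for y
  proof -
    have "r ` (\<sigma> -` {(0, y)}) \<subseteq> m -` {y}"
      using mr by auto
    moreover have "large (r ` (\<sigma> -` {(0, y)}))"
      by (rule large_inj_image[OF large_sigma inj_on_subset[OF bij_betw_imp_inj_on[OF r]]]) simp
    ultimately show ?thesis using small_mono by blast
  qed
  then have "range m = UNIV"
    using large_not_empty[OF fib] by (auto simp: set_eq_iff) (metis rangeI)
  then have "range (\<lambda>x. \<phi> (\<sigma> x)) = range m"
    using assms range_comp_sigma by metis
  then obtain \<pi> where \<pi>: "bij \<pi>" "(\<lambda>x. \<phi> (\<sigma> x)) = m \<circ> \<pi>"
    using bij_of_large_fibres[of "\<lambda>x. \<phi> (\<sigma> x)" m] large_fibres_comp_sigma fib by blast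
  then show ?thesis using m(1) M_comp M_bij by simp
qed

text \<open>The values missed by the non-constant components are added on a set of arguments whose image
  in \<open>X\<^sup>n\<close> is small: the diagonal tuples over the small set of missed values, corrected at the
  constant components.\<close>

lemma M_perturb:
  assumes f: "(n, f) \<in> C" "\<forall>x. length (a x) = n"
    and a: "\<forall>i<n. almost_surj (\<lambda>x. a x ! i) \<or> (\<exists>c. (\<lambda>x. a x ! i) = (\<lambda>_. c) \<and> (\<lambda>_. c) \<in> M)"
  obtains h S where "h \<in> M" "small S" "range (\<lambda>x. f (a x)) \<subseteq> range h"
    "range h \<subseteq> range (\<lambda>x. f (a x)) \<union> S"
proof -
  let ?I = "{i. i < n \<and> almost_surj (\<lambda>x. a x ! i)}"
  define N where "N = (\<Union>i\<in>?I. - range (\<lambda>x. a x ! i))"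
  have N: "small N"
    unfolding N_def by (intro small_UN_finite) (auto simp: almost_surj_def Compl_eq_Diff_UNIV)
  \<comment> \<open>Outside \<open>?I\<close> the components of \<open>a\<close> are constant, so
    they may be read off at \<open>undefined\<close>.\<close>
  define b where "b \<nu> = map (\<lambda>i. if i \<in> ?I then \<nu> else a undefined ! i) [0..<n]" for \<nu>
  define \<phi> where "\<phi> = (\<lambda>(j :: nat, x). if j = 0 \<or> x \<notin> N then a x else b x)"
  have len: "length (\<phi> p) = n" for p
    using f(2) by (auto simp: \<phi>_def b_def split: prod.split)
  have "(\<lambda>x. \<phi> (\<sigma> x) ! i) \<in> M" if i: "i < n" for i
  proof (cases "i \<in> ?I")
    case True
    have "\<exists>p. \<phi> p ! i = y" for y
    proof (cases "y \<in> range (\<lambda>x. a x ! i)")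
      case True
      then obtain x where "y = a x ! i" by auto
      then have "\<phi> (0, x) ! i = y" by (simp add: \<phi>_def)
      then show ?thesis by blast
    next
      case False
      then have "y \<in> N" using True by (auto simp: N_def)
      then have "\<phi> (1, y) ! i = y" using True i by (simp add: \<phi>_def b_def)
      then show ?thesis by blast
    qed
    then have "surj (\<lambda>p. \<phi> p ! i)" unfolding surj_def by metis
    then show ?thesis by (rule M_surj_sigma)
  next
    case False
    then obtain c where c: "(\<lambda>x. a x ! i) = (\<lambda>_. c)" "(\<lambda>_. c) \<in> M"
      using a i by blast
    have "a x ! i = c" for x using c(1) by metis
    then have "(\<lambda>x. \<phi> (\<sigma> x) ! i) = (\<lambda>_. c)"
      using False i by (auto simp: \<phi>_def b_def fun_eq_iff split: prod.split)
    with c(2) show ?thesis by simp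
  qed
  then have "(\<lambda>x. f (\<phi> (\<sigma> x))) \<in> M"
    using C_apply[OF f(1), of "\<lambda>x. \<phi> (\<sigma> x)"] len by blast
  moreover have "range (\<lambda>x. f (\<phi> (\<sigma> x))) = range (\<lambda>p. f (\<phi> p))"
    using range_comp_sigma[of "\<lambda>p. f (\<phi> p)"] .
  moreover have "range (\<lambda>x. f (a x)) \<subseteq> range (\<lambda>p. f (\<phi> p))"
  proof (intro image_subsetI)
    fix x
    have "f (a x) = f (\<phi> (0, x))" by (simp add: \<phi>_def)
    then show "f (a x) \<in> range (\<lambda>p. f (\<phi> p))" by blast
  qed
  moreover have "range (\<lambda>p. f (\<phi> p)) \<subseteq> range (\<lambda>x. f (a x)) \<union> (\<lambda>\<nu>. f (b \<nu>)) ` N"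
    by (auto simp: \<phi>_def)
  ultimately show thesis
    by (intro that[of "\<lambda>x. f (\<phi> (\<sigma> x))" "(\<lambda>\<nu>. f (b \<nu>)) ` N"] small_image[OF N]) simp_all
qed

text \<open>Failing \<open>monoid_E\<close> gives a member of \<open>M\<close> with large co-range.
  If it is constant, then all constants lie in \<open>M\<close>, which is exactly what
  \<open>M_perturb\<close> needs for the constant components in a failure of
  \<open>monoid_F\<close>.\<close>

lemma M_not_almost_surj:
  assumes E: "\<not> C \<subseteq> Pol monoid_E" and F: "\<not> C \<subseteq> Pol monoid_F"
  obtains e where "e \<in> M" "large (- range e)" "\<not> (\<exists>c. e = (\<lambda>_. c))"
proof -
  obtain n f a where f: "(n, f) \<in> C" "1 \<le> n" "\<forall>x. length (a x) = n"
    "\<And>i. i < n \<Longrightarrow> (\<lambda>x. a x ! i) \<in> monoid_E" "(\<lambda>x. f (a x)) \<notin> monoid_E"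
    using C_break[OF E] by blast
  have "large (- range (\<lambda>x. f (a x)))"
    using f(5) by (simp add: monoid_E_def almost_surj_def Compl_eq_Diff_UNIV)
  have "\<forall>i<n. almost_surj (\<lambda>x. a x ! i) \<or> (\<exists>c. (\<lambda>x. a x ! i) = (\<lambda>_. c) \<and> (\<lambda>_. c) \<in> M)"
    using f(4) by (simp add: monoid_E_def)
  then obtain h S where h: "h \<in> M" "small S" "range (\<lambda>x. f (a x)) \<subseteq> range h"
    "range h \<subseteq> range (\<lambda>x. f (a x)) \<union> S"
    by (rule M_perturb[OF f(1,3)])
  have "- range (\<lambda>x. f (a x)) - S \<subseteq> - range h" using h(4) by blast
  then have hE: "large (- range h)"
    using large_Diff[OF \<open>large (- range (\<lambda>x. f (a x)))\<close> h(2)] small_mono by blast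
  show thesis
  proof (cases "\<exists>c. h = (\<lambda>_. c)")
    case False
    with h(1) hE that show thesis by blast
  next
    case True
    have const: "(\<lambda>_. c) \<in> M" for c
      using M_comp_of_colarge[OF h(1) hE, of "\<lambda>_. c"] .
    obtain n f a where f: "(n, f) \<in> C" "1 \<le> n" "\<forall>x. length (a x) = n"
      "\<And>i. i < n \<Longrightarrow> (\<lambda>x. a x ! i) \<in> monoid_F" "(\<lambda>x. f (a x)) \<notin> monoid_F"
      using C_break[OF F] by blast
    have fa: "large (- range (\<lambda>x. f (a x)))" "\<not> (\<exists>c. (\<lambda>x. f (a x)) = (\<lambda>_. c))"
      using f(5) by (simp_all add: monoid_F_def almost_surj_def Compl_eq_Diff_UNIV)
    have "\<forall>i<n. almost_surj (\<lambda>x. a x ! i) \<or> (\<exists>c. (\<lambda>x. a x ! i) = (\<lambda>_. c) \<and> (\<lambda>_. c) \<in> M)"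
      using f(4) const by (simp add: monoid_F_def)
    then obtain g S where g: "g \<in> M" "small S" "range (\<lambda>x. f (a x)) \<subseteq> range g"
      "range g \<subseteq> range (\<lambda>x. f (a x)) \<union> S"
      by (rule M_perturb[OF f(1,3)])
    have "- range (\<lambda>x. f (a x)) - S \<subseteq> - range g" using g(4) by blast
    then have "large (- range g)"
      using large_Diff[OF fa(1) g(2)] small_mono by blast
    moreover have "\<not> (\<exists>c. g = (\<lambda>_. c))"
    proof
      assume "\<exists>c. g = (\<lambda>_. c)"
      then obtain c where "range g \<subseteq> {c}" by auto
      then have "f (a x) = c" for x using g(3) by blast
      then have "(\<lambda>x. f (a x)) = (\<lambda>_. c)" by blast
      then show False using fa(2) by blast
    qed
    ultimately show thesis using g(1) that by blast
  qed
qed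

lemma M_two_valued:
  assumes e: "e \<in> M" "large (- range e)" "\<not> (\<exists>c. e = (\<lambda>_. c))"
  shows "(\<lambda>x. if fst (\<sigma> x) = 0 then c else d) \<in> M"
proof -
  obtain u v where uv: "e u \<noteq> e v" using e(3) by (metis ext)
  let ?Q = "e -` {e u}"
  \<comment> \<open>Block 0 is sent into the fibre \<open>?Q\<close> and the other blocks out of it,
    with \<open>u\<close> and \<open>v\<close> as defaults, while each point is still attained. Thus
    \<open>e\<close> tells block 0 from the rest, and its co-range is large enough to recode the
    values.\<close>
  define \<phi> where "\<phi> = (\<lambda>(j :: nat, y). if j = 0 then if y \<in> ?Q then y else u else if y \<in> ?Q then v else y)"
  have "\<phi> (if y \<in> ?Q then 0 else 1, y) = y" for y by (simp add: \<phi>_def)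
  then have "surj \<phi>" by (rule surjI)
  then have "(\<lambda>x. \<phi> (\<sigma> x)) \<in> M" by (rule M_surj_sigma)
  then have "e \<circ> (\<lambda>x. \<phi> (\<sigma> x)) \<in> M" using M_comp e(1) by blast
  moreover have "range (e \<circ> (\<lambda>x. \<phi> (\<sigma> x))) \<subseteq> range e" by auto
  then have "large (- range (e \<circ> (\<lambda>x. \<phi> (\<sigma> x))))"
    using e(2) small_mono by (metis Compl_subset_Compl_iff)
  ultimately have "(\<lambda>x. (\<lambda>y. if y = e u then c else d) ((e \<circ> (\<lambda>x. \<phi> (\<sigma> x))) x)) \<in> M"
    by (rule M_comp_of_colarge)
  moreover have "e (\<phi> p) = e u \<longleftrightarrow> fst p = 0" for p
    using uv by (cases p) (simp add: \<phi>_def)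
  ultimately show ?thesis by simp
qed

text \<open>For an operation \<open>f\<close> that is not almost unary, tuples covering all values of every coordinate are
  chosen such that \<open>f\<close> is injective on representatives of them and misses many values, simply by
  choosing distinct values from the large sets \<open>R k c\<close> and from further copies of \<open>X\<close>.\<close>

lemma C_almost_unary:
  assumes two: "\<And>c d. (\<lambda>x. if fst (\<sigma> x) = 0 then c else d) \<in> M"
    and no: "\<And>h. h \<in> M \<Longrightarrow> large (- range h) \<Longrightarrow> small (range h)"
  shows "C \<subseteq> almost_unary"
proof (rule subsetI, rule ccontr)
  fix p assume "p \<in> C" "p \<notin> almost_unary"
  then obtain n f where nf: "(n, f) \<in> C" "(n, f) \<notin> almost_unary" by (cases p) auto
  have n: "1 \<le> n" using C_arity nf(1) by blast
  define R where "R k c = f ` {xs \<in> tuples n. xs ! k = c}" for k c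
  have ex: "\<exists>c. large (R k c)" if "k < n" for k
    using nf that C_ops by (auto simp: almost_unary_def R_def)
  \<comment> \<open>If entry \<open>k\<close> fixed at \<open>c\<close> allows many results and at
    \<open>d\<close> few, let entry \<open>k\<close> take just these two values: block 0 realizes
    the results in \<open>Y\<close>, the other blocks make the remaining entries onto. The range
    contains \<open>Y\<close> but misses most of \<open>Z\<close>, against
    \<open>no\<close>.\<close>
  have all: "large (R k d)" if k: "k < n" for k d
  proof
    assume d: "small (R k d)"
    obtain c where c: "large (R k c)" using ex[OF k] by blast
    obtain Y Z where YZ: "R k c = Y \<union> Z" "Y \<inter> Z = {}" "large Y" "large Z"
      using split_large[OF c] .
    obtain \<rho> where \<rho>: "bij_betw \<rho> (UNIV :: 'a set) Y" using large_surj[OF YZ(3)] .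
    have "\<forall>y. \<exists>xs. xs \<in> tuples n \<and> xs ! k = c \<and> f xs = \<rho> y"
    proof
      fix y
      have "\<rho> y \<in> R k c" using \<rho> YZ(1) by (auto simp: bij_betw_def)
      then show "\<exists>xs. xs \<in> tuples n \<and> xs ! k = c \<and> f xs = \<rho> y"
        unfolding R_def by (auto simp: image_iff)
    qed
    then obtain \<theta> where \<theta>: "\<forall>y. \<theta> y \<in> tuples n \<and> \<theta> y ! k = c \<and> f (\<theta> y) = \<rho> y"
      by metis
    define \<phi> where "\<phi> p = (if fst p = 0 then \<theta> (snd p) else (replicate n (snd p))[k := d])"
      for p :: "nat \<times> 'a"
    have len: "\<phi> p \<in> tuples n" for p
      using \<theta> by (simp add: \<phi>_def tuples_def)
    have "(\<lambda>x. \<phi> (\<sigma> x) ! i) \<in> M" if i: "i < n" for i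
    proof (cases "i = k")
      case True
      have "(\<lambda>x. \<phi> (\<sigma> x) ! i) = (\<lambda>x. if fst (\<sigma> x) = 0 then c else d)"
        using True k \<theta> by (auto simp: \<phi>_def)
      then show ?thesis using two by simp
    next
      case False
      then have "\<phi> (1, y) ! i = y" for y using i by (simp add: \<phi>_def)
      then have "surj (\<lambda>p. \<phi> p ! i)" unfolding surj_def by metis
      then show ?thesis by (rule M_surj_sigma)
    qed
    then have h: "(\<lambda>x. f (\<phi> (\<sigma> x))) \<in> M"
      using C_apply[OF nf(1), of "\<lambda>x. \<phi> (\<sigma> x)"] len by (auto simp: tuples_def)
    have r: "range (\<lambda>x. f (\<phi> (\<sigma> x))) = range (\<lambda>p. f (\<phi> p))"
      using range_comp_sigma[of "\<lambda>p. f (\<phi> p)"] .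
    have "f (\<phi> p) \<in> Y \<union> R k d" for p
    proof (cases "fst p = 0")
      case True
      then show ?thesis using \<theta> \<rho> by (auto simp: \<phi>_def bij_betw_def)
    next
      case False
      then show ?thesis using len[of p] k by (auto simp: \<phi>_def R_def)
    qed
    then have "Z - R k d \<subseteq> - range (\<lambda>x. f (\<phi> (\<sigma> x)))"
      using YZ(2) unfolding r by blast
    then have "large (- range (\<lambda>x. f (\<phi> (\<sigma> x))))"
      using large_Diff[OF YZ(4) d] small_mono by blast
    then have "small (range (\<lambda>x. f (\<phi> (\<sigma> x))))" by (rule no[OF h])
    moreover have "Y \<subseteq> range (\<lambda>x. f (\<phi> (\<sigma> x)))"
    proof
      fix z assume "z \<in> Y"
      then obtain y where "z = \<rho> y" using \<rho> by (auto simp: bij_betw_def)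
      then have "z = f (\<phi> (0, y))" using \<theta> by (simp add: \<phi>_def)
      then show "z \<in> range (\<lambda>x. f (\<phi> (\<sigma> x)))" unfolding r by blast
    qed
    ultimately show False using YZ(3) small_mono by blast
  qed
  define T where "T = (\<lambda>(k, c). if k < n then R k c else UNIV)"
  have T: "\<forall>p. large (T p)" using all by (auto simp: T_def)
  obtain e :: "nat \<times> 'a \<Rightarrow> 'a" where e: "inj e" using ex_inj_nat_times .
  have "\<forall>x :: 'a. small {y. x = y}"
    by (auto intro: small_finite)
  from large_nonconflicting_choice[OF e T this symp_on_equality]
  obtain s where s: "\<forall>p. s p \<in> T p" "\<forall>p q. p \<noteq> q \<longrightarrow> s p \<noteq> s q"
    by auto
  have "inj s" using s(2) by (metis injI)
  note sD = injD[OF this]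
  \<comment> \<open>Indices from \<open>n\<close> on are redirected to block 0, so the values chosen
    for block \<open>n\<close> are never attained.\<close>
  define q where "q p = (if fst p < n then p else (0, snd p))" for p :: "nat \<times> 'a"
  have q: "fst (q p) < n" for p using n by (simp add: q_def)
  have "\<exists>xs. xs \<in> tuples n \<and> xs ! fst (q p) = snd (q p) \<and> f xs = s (q p)" for p
  proof -
    have "s (q p) \<in> R (fst (q p)) (snd (q p))"
      using s(1)[rule_format, of "q p"] q[of p] by (simp add: T_def split_beta)
    then show ?thesis unfolding R_def by (auto simp: image_iff)
  qed
  then obtain \<phi> where \<phi>: "\<forall>p. \<phi> p \<in> tuples n \<and> \<phi> p ! fst (q p) = snd (q p) \<and> f (\<phi> p) = s (q p)"
    by metis
  have "(\<lambda>x. \<phi> (\<sigma> x) ! i) \<in> M" if "i < n" for i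
  proof (rule M_surj_sigma)
    have "\<phi> (i, c) ! i = c" for c
      using \<phi>[rule_format, of "(i, c)"] that by (simp add: q_def)
    then show "surj (\<lambda>p. \<phi> p ! i)" unfolding surj_def by metis
  qed
  then have h: "(\<lambda>x. f (\<phi> (\<sigma> x))) \<in> M"
    using C_apply[OF nf(1), of "\<lambda>x. \<phi> (\<sigma> x)"] \<phi> by (simp only: tuples_def mem_Collect_eq)
  have r: "range (\<lambda>x. f (\<phi> (\<sigma> x))) = range (\<lambda>p. s (q p))"
  proof -
    have "f (\<phi> p) = s (q p)" for p using \<phi> by blast
    then show ?thesis using range_comp_sigma[of "\<lambda>p. f (\<phi> p)"] by simp
  qed
  have "large (range (\<lambda>c. s (k, c)))" for k
    by (intro large_inj_image) (auto intro!: inj_onI dest: sD)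
  moreover have "range (\<lambda>c. s (n, c)) \<subseteq> - range (\<lambda>p. s (q p))"
  proof
    fix z assume "z \<in> range (\<lambda>c. s (n, c))"
    then obtain c where c: "z = s (n, c)" by auto
    have False if "z = s (q p)" for p
    proof -
      have "s (n, c) = s (q p)" using c that by simp
      then have "(n, c) = q p" by (rule sD)
      then have "fst (q p) = n" by (metis fst_conv)
      with q[of p] show False by simp
    qed
    then show "z \<in> - range (\<lambda>p. s (q p))" by blast
  qed
  moreover have "range (\<lambda>c. s (0, c)) \<subseteq> range (\<lambda>p. s (q p))"
  proof (intro image_subsetI)
    fix c
    have "q (0, c) = (0, c)" using n by (simp add: q_def)
    then show "s (0, c) \<in> range (\<lambda>p. s (q p))" by (metis rangeI)
  qed
  ultimately show False
    using no[OF h] small_mono unfolding r by blast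
qed

text \<open>\<open>u\<close> has the range of \<open>h\<close> and only large non-empty fibres. This
  range is large, so following \<open>u\<close> by a suitable \<open>k\<close> yields the range of
  \<open>r\<close>, and equal ranges with large fibres leave only a permutation.\<close>

lemma M_large_fibres:
  assumes h: "h \<in> M" "large (range h)" "large (- range h)"
    and r: "\<And>x. large (r -` {r x})"
  shows "r \<in> M"
proof -
  obtain \<omega> where \<omega>: "bij_betw \<omega> (range h) (UNIV :: 'a set)"
    using bij_betw_large[OF h(2) large_UNIV] .
  define u where "u x = h (snd (\<sigma> x))" for x
  have uM: "u \<in> M"
  proof -
    have "surj (snd :: nat \<times> 'a \<Rightarrow> 'a)" by (metis snd_conv surj_def)
    then have "h \<circ> (\<lambda>x. snd (\<sigma> x)) \<in> M" using M_comp[OF h(1)] M_surj_sigma by blast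
    then show ?thesis by (simp add: u_def[abs_def] comp_def)
  qed
  have ru: "range u = range h"
    using range_comp_sigma[of "\<lambda>p. h (snd p)"] by (auto simp: u_def[abs_def])
      (metis image_iff rangeI snd_conv)
  have coU: "large (- range u)" using h(3) ru by simp
  define k where "k y = r (\<omega> y)" for y
  have k: "k ` range h = range r"
    using bij_betw_imp_surj_on[OF \<omega>] by (metis image_image k_def image_cong)
  then have "range r = range (\<lambda>x. k (u x))"
    using ru by (metis image_image)
  moreover have "large ((\<lambda>x. k (u x)) -` {k (u x)})" for x
    unfolding u_def using large_fibres_comp_sigma[of "\<lambda>p. k (h (snd p))"] .
  ultimately obtain \<pi> where \<pi>: "bij \<pi>" "r = (\<lambda>x. k (u x)) \<circ> \<pi>"
    using bij_of_large_fibres[of r "\<lambda>x. k (u x)"] r by blast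
  then show ?thesis
    using M_comp[OF M_comp_of_colarge[OF uM coU]] M_bij by simp
qed

end

section \<open>Dominating values\<close>

context regular_universe
begin

lemma large_fibre_or_small_fibres_list:
  fixes w :: "nat \<Rightarrow> 'a \<Rightarrow> 'a"
  assumes "large Y"
  shows "\<exists>Z\<subseteq>Y. large Z \<and> (\<forall>i<n. (\<exists>c. \<forall>x\<in>Z. w i x = c) \<or> (\<forall>c. small (w i -` {c} \<inter> Z)))"
proof (induction n)
  case 0
  with assms show ?case by auto
next
  case (Suc n)
  then obtain Z where Z: "Z \<subseteq> Y" "large Z"
    "\<forall>i<n. (\<exists>c. \<forall>x\<in>Z. w i x = c) \<or> (\<forall>c. small (w i -` {c} \<inter> Z))"
    by blast
  obtain Z' where Z': "Z' \<subseteq> Z" "large Z'"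
    "(\<exists>c. \<forall>x\<in>Z'. w n x = c) \<or> (\<forall>c. small (w n -` {c} \<inter> Z'))"
    using large_fibre_or_small_fibres[OF Z(2)] .
  have "(\<exists>c. \<forall>x\<in>Z'. w i x = c) \<or> (\<forall>c. small (w i -` {c} \<inter> Z'))" if "i < n" for i
  proof -
    have "w i -` {c} \<inter> Z' \<subseteq> w i -` {c} \<inter> Z" for c
      using Z'(1) by auto
    then show ?thesis
      using Z(3) that Z'(1) small_mono by (meson subsetD)
  qed
  then have "\<forall>i<Suc n. (\<exists>c. \<forall>x\<in>Z'. w i x = c) \<or> (\<forall>c. small (w i -` {c} \<inter> Z'))"
    using Z'(3) by (metis less_Suc_eq)
  moreover have "Z' \<subseteq> Y" using Z(1) Z'(1) by blast
  ultimately show ?case using Z'(2) by blast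
qed

text \<open>Each entry of a chosen tuple must later recur in another tuple with a different result;
  a dominating entry is what prevents this.\<close>

definition dominating :: "nat \<Rightarrow> ('a list \<Rightarrow> 'a) \<Rightarrow> nat \<Rightarrow> 'a \<Rightarrow> 'a \<Rightarrow> bool" where
  "dominating n f i v z \<longleftrightarrow> (\<forall>b. length b = n \<and> b ! i = v \<longrightarrow> f b = z)"

text \<open>As the coordinates differ, some tuple carries both entries.\<close>

lemma dominating_unique:
  assumes "dominating n f i v z" "dominating n f j u z'" "i < n" "j < n" "i \<noteq> j"
  shows "z = z'"
proof -
  let ?b = "(replicate n v)[j := u]"
  have "length ?b = n" "?b ! i = v" "?b ! j = u" using assms(3-5) by simp_all
  then show ?thesis using assms(1,2) unfolding dominating_def by metis
qed

text \<open>If dominating values exist for two coordinates, they all force the same result; if they exist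
  for the coordinate \<open>j\<close> only, then \<open>c j\<close> is not one of them.\<close>

lemma ex_few_dominating:
  fixes f :: "'a list \<Rightarrow> 'a" and a :: "'a \<Rightarrow> 'a list"
  assumes n: "1 \<le> n" and a: "\<forall>x. length (a x) = n"
    and L: "\<And>i. i < n \<Longrightarrow> large {x. a x ! i = c i}"
    and small: "\<And>z. small {x. f (a x) = z}"
  shows "\<exists>j<n. small {x. a x ! j = c j \<and> (\<exists>i<n. \<exists>z. dominating n f i (a x ! i) z)}"
proof (cases "\<exists>i<n. \<exists>j<n. i \<noteq> j \<and> (\<exists>v z. dominating n f i v z) \<and> (\<exists>v z. dominating n f j v z)")
  case True
  then obtain i j v z v' z' where ij: "i < n" "j < n" "i \<noteq> j"
    "dominating n f i v z" "dominating n f j v' z'" by blast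
  have "z'' = z" if "p < n" "dominating n f p u z''" for p u z''
    using that ij dominating_unique by metis
  then have "f (a x) = z" if "p < n" "dominating n f p (a x ! p) z''" for p x z''
    using that a unfolding dominating_def by metis
  then have "{x. a x ! 0 = c 0 \<and> (\<exists>i<n. \<exists>z. dominating n f i (a x ! i) z)} \<subseteq> {x. f (a x) = z}"
    by blast
  then have "small {x. a x ! 0 = c 0 \<and> (\<exists>i<n. \<exists>z. dominating n f i (a x ! i) z)}"
    using small small_mono by blast
  then show ?thesis using n by (intro exI[of _ 0]) simp
next
  case False
  then obtain j where j: "j < n" "\<And>i v z. i < n \<Longrightarrow> dominating n f i v z \<Longrightarrow> i = j"
    using n by (metis less_le_trans zero_less_one)
  have "\<not> dominating n f i (a x ! i) z" if "a x ! j = c j" "i < n" for i x z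
  proof
    assume d: "dominating n f i (a x ! i) z"
    then have "i = j" using j(2) that(2) by blast
    then have "dominating n f j (c j) z" using d that(1) by simp
    then have "{x. a x ! j = c j} \<subseteq> {x. f (a x) = z}"
      using a by (auto simp: dominating_def)
    then show False using L[OF j(1)] small small_mono by blast
  qed
  then have "{x. a x ! j = c j \<and> (\<exists>i<n. \<exists>z. dominating n f i (a x ! i) z)} = {}" by blast
  then have "small {x. a x ! j = c j \<and> (\<exists>i<n. \<exists>z. dominating n f i (a x ! i) z)}"
    by (simp only: small_finite[OF finite.emptyI])
  then show ?thesis using j(1) by blast
qed

text \<open>Undominated tuples have, for each entry, a partner \<open>b i x\<close> with another
  result. Thinning separates all partner results from all results kept in \<open>R\<close>, so
  partners can later supply repeated entries without disturbing injectivity.\<close>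

lemma ex_undominated_transversal:
  fixes f :: "'a list \<Rightarrow> 'a" and a :: "'a \<Rightarrow> 'a list"
  assumes n: "1 \<le> n" and a: "\<forall>x. length (a x) = n"
    and L: "\<And>i. i < n \<Longrightarrow> large {x. a x ! i = c i}"
    and small: "\<And>z. small {x. f (a x) = z}"
  obtains R b where "large R" "inj_on (\<lambda>x. f (a x)) R"
    "\<forall>i<n. \<forall>x\<in>R. length (b i x) = n \<and> b i x ! i = a x ! i \<and> (\<forall>y\<in>R. f (b i x) \<noteq> f (a y))"
proof -
  obtain j where j: "j < n"
    "small {x. a x ! j = c j \<and> (\<exists>i<n. \<exists>z. dominating n f i (a x ! i) z)}"
    using ex_few_dominating[of n a c f] n a L small by blast
  define R0 where "R0 = {x. a x ! j = c j} - {x. a x ! j = c j \<and> (\<exists>i<n. \<exists>z. dominating n f i (a x ! i) z)}"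
  have R0: "large R0" unfolding R0_def by (rule large_Diff[OF L[OF j(1)] j(2)])
  have "\<exists>b. length b = n \<and> b ! i = a x ! i \<and> f b \<noteq> f (a x)" if "x \<in> R0" "i < n" for i x
    using that unfolding R0_def dominating_def by blast
  then have "\<forall>i x. \<exists>b. x \<in> R0 \<and> i < n \<longrightarrow> length b = n \<and> b ! i = a x ! i \<and> f b \<noteq> f (a x)"
    by blast
  from this[unfolded choice_iff] obtain b where b: "\<forall>i x. x \<in> R0 \<and> i < n \<longrightarrow>
      length (b i x) = n \<and> b i x ! i = a x ! i \<and> f (b i x) \<noteq> f (a x)"
    by blast
  define w where "w i x = f (b i x)" for i x
  obtain Z where Z: "Z \<subseteq> R0" "large Z"
    "\<forall>i<n. (\<exists>c. \<forall>x\<in>Z. w i x = c) \<or> (\<forall>c. small (w i -` {c} \<inter> Z))"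
    using large_fibre_or_small_fibres_list[OF R0, of n w] by blast
  \<comment> \<open>Partner results constant on \<open>Z\<close> are avoided by deleting one small
    fibre of the result for each. The remaining ones have small fibres on \<open>Z\<close>, so
    conflicts are few in both directions and \<open>Q\<close> removes them.\<close>
  let ?K = "{i. i < n \<and> (\<exists>c. \<forall>x\<in>Z. w i x = c)}"
  let ?J = "{i. i < n \<and> (\<forall>c. small (w i -` {c} \<inter> Z))}"
  have "\<exists>c. \<forall>i\<in>?K. \<forall>x\<in>Z. w i x = c i" by (intro bchoice) auto
  then obtain d where d: "\<And>i x. i \<in> ?K \<Longrightarrow> x \<in> Z \<Longrightarrow> w i x = d i" by blast
  let ?Z = "Z - (\<Union>i\<in>?K. {x. f (a x) = d i})"
  have Z': "large ?Z"
    by (intro large_Diff[OF Z(2)] small_UN_finite small) auto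
  define Q where "Q x y \<longleftrightarrow> f (a x) = f (a y) \<or>
    (x \<in> Z \<and> y \<in> Z \<and> (\<exists>i\<in>?J. w i x = f (a y) \<or> w i y = f (a x)))" for x y
  have "{y. Q x y} \<subseteq> {y. f (a y) = f (a x)} \<union>
      (\<Union>i\<in>?J. {y. f (a y) = w i x} \<union> (w i -` {f (a x)} \<inter> Z))" for x
    by (auto simp: Q_def)
  moreover have "small ({y. f (a y) = f (a x)} \<union>
      (\<Union>i\<in>?J. {y. f (a y) = w i x} \<union> (w i -` {f (a x)} \<inter> Z)))" for x
    by (intro small_Un small_UN_finite small) auto
  ultimately have Q: "\<forall>x. small {y. Q x y}" using small_mono by blast
  have "symp Q" by (rule sympI) (auto simp: Q_def)
  from thin_large[OF Z' Q this]
  obtain R where R: "R \<subseteq> ?Z" "large R" "\<forall>x\<in>R. \<forall>y\<in>R. x \<noteq> y \<longrightarrow> \<not> Q x y"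
    by auto
  have "w i x \<noteq> f (a y)" if "i < n" "x \<in> R" "y \<in> R" for i x y
  proof (cases "x = y")
    case True
    then show ?thesis using b that R(1) Z(1) by (auto simp: w_def)
  next
    case False
    have xy: "x \<in> Z" "y \<in> Z" using that R(1) by auto
    have "\<not> Q x y" using R(3) that False by blast
    then have "i \<in> ?J \<Longrightarrow> ?thesis" using xy unfolding Q_def by blast
    moreover have ?thesis if K: "i \<in> ?K"
    proof -
      have "y \<in> ?Z" using R(1) \<open>y \<in> R\<close> by (rule subsetD)
      then have "f (a y) \<noteq> d i" using K by blast
      then show ?thesis using d[OF K xy(1)] by simp
    qed
    ultimately show ?thesis using Z(3) that(1) by blast
  qed
  moreover have "inj_on (\<lambda>x. f (a x)) R"
    using R(3) unfolding Q_def inj_on_def by blast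
  moreover have "R \<subseteq> R0" using R(1) Z(1) by blast
  ultimately show thesis
    using that[OF R(2), of b] b unfolding w_def by (metis subsetD)
qed

end

context extending_monoid
begin

text \<open>The undominated tuples are taken once each on \<open>P\<close>; on the complement of \<open>P\<close> every component value
  is repeated often, inside tuples whose results do not interfere. Thus all components have only
  large non-empty fibres although the result is injective on \<open>P\<close>.\<close>

lemma M_inj_on_large:
  assumes h: "h \<in> M" "large (range h)" "large (- range h)"
    and U: "\<not> C \<subseteq> Pol large_fibre"
  obtains g P where "g \<in> M" "large P" "large (- P)" "inj_on g P" "g ` P \<inter> g ` (- P) = {}"
    "large (- range g)"
proof -
  obtain n f a where f: "(n, f) \<in> C" "1 \<le> n" "\<forall>x. length (a x) = n"
    "\<forall>i<n. (\<lambda>x. a x ! i) \<in> large_fibre" "(\<lambda>x. f (a x)) \<notin> large_fibre"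
    using C_break[OF U] by blast
  have "\<forall>i. \<exists>c. i < n \<longrightarrow> large {x. a x ! i = c}"
    using f(4) by (auto simp: large_fibre_def vimage_def)
  then obtain c where c: "\<And>i. i < n \<Longrightarrow> large {x. a x ! i = c i}"
    by metis
  have small: "small {x. f (a x) = z}" for z
    using f(5) by (auto simp: large_fibre_def vimage_def)
  obtain R b where R: "large R" "inj_on (\<lambda>x. f (a x)) R"
    and b: "\<forall>i<n. \<forall>x\<in>R. length (b i x) = n \<and> b i x ! i = a x ! i \<and> (\<forall>y\<in>R. f (b i x) \<noteq> f (a y))"
    using ex_undominated_transversal[OF f(2,3) c small] by blast
  \<comment> \<open>The results over \<open>R2\<close> are reserved: they will be missed and make
    the co-range large.\<close>
  obtain R1 R2 where R12: "R = R1 \<union> R2" "R1 \<inter> R2 = {}" "large R1" "large R2"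
    using split_large[OF R(1)] .
  obtain P :: "'a set" where P: "large P" "large (- P)" using ex_half .
  obtain \<rho> where \<rho>: "bij_betw \<rho> (UNIV :: 'a set) R1" using large_surj[OF R12(3)] .
  obtain \<alpha> where \<alpha>: "bij_betw \<alpha> P (UNIV :: 'a set)" using bij_betw_large[OF P(1) large_UNIV] .
  obtain \<beta> where \<beta>: "bij_betw \<beta> (- P) (UNIV :: 'a set)" using bij_betw_large[OF P(2) large_UNIV] .
  \<comment> \<open>\<open>\<sigma>\<close> has infinitely many blocks but only \<open>n\<close>
    families of partners exist, so the surplus blocks repeat family 0.\<close>
  define d where "d p = (if fst p < n then b (fst p) (\<rho> (snd p)) else b 0 (\<rho> (snd p)))"
    for p :: "nat \<times> 'a"
  define t where "t x = (if x \<in> P then a (\<rho> (\<alpha> x)) else d (\<sigma> (\<beta> x)))" for x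
  have \<rho>R: "\<rho> y \<in> R1" "\<rho> y \<in> R" for y
    using \<rho> R12(1) by (auto simp: bij_betw_def)
  have d: "length (d p) = n" "y \<in> R \<Longrightarrow> f (d p) \<noteq> f (a y)" for p y
    using b \<rho>R f(2) by (auto simp: d_def)
  have fib: "large {x. t x ! i = d p ! i}" if "i < n" for i p
  proof -
    have "large (\<sigma> -` {p})" by (rule large_sigma)
    then have "large (\<beta> -` (\<sigma> -` {p}) \<inter> - P)"
      by (rule large_vimage) (use \<beta> in \<open>simp add: bij_betw_def\<close>)
    moreover have "\<beta> -` (\<sigma> -` {p}) \<inter> - P \<subseteq> {x. t x ! i = d p ! i}"
      by (auto simp: t_def)
    ultimately show ?thesis using small_mono by blast
  qed
  have "(\<lambda>x. t x ! i) \<in> M" if i: "i < n" for i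
  proof (rule M_large_fibres[OF h])
    fix x
    have "\<exists>p. t x ! i = d p ! i"
    proof (cases "x \<in> P")
      case True
      then have "t x ! i = d (i, \<alpha> x) ! i"
        using b i \<rho>R by (simp add: t_def d_def)
      then show ?thesis ..
    next
      case False
      then have "t x ! i = d (\<sigma> (\<beta> x)) ! i" by (simp add: t_def)
      then show ?thesis ..
    qed
    then obtain p where "t x ! i = d p ! i" ..
    then show "large ((\<lambda>x. t x ! i) -` {t x ! i})"
      using fib[OF i, of p] by (simp add: vimage_def)
  qed
  moreover have "length (t x) = n" for x
    using d(1) f(3) by (simp add: t_def)
  ultimately have M: "(\<lambda>x. f (t x)) \<in> M"
    using C_apply[OF f(1), of t] by blast
  have tP: "f (t x) = f (a (\<rho> (\<alpha> x)))" if "x \<in> P" for x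
    using that by (simp add: t_def)
  have "inj_on (\<lambda>x. f (t x)) P"
  proof (rule inj_onI)
    fix x y assume xy: "x \<in> P" "y \<in> P" "f (t x) = f (t y)"
    then have "\<rho> (\<alpha> x) = \<rho> (\<alpha> y)"
      using tP inj_onD[OF R(2)] \<rho>R by simp
    then have "\<alpha> x = \<alpha> y" using injD[OF bij_betw_imp_inj_on[OF \<rho>]] by blast
    then show "x = y" using inj_onD[OF bij_betw_imp_inj_on[OF \<alpha>]] xy by blast
  qed
  moreover have tP': "f (t x) \<noteq> f (a y)" if "x \<notin> P" "y \<in> R" for x y
    using that d(2) by (simp add: t_def)
  have "f (t x) \<noteq> f (t y)" if "x \<in> P" "y \<notin> P" for x y
    using tP[OF that(1)] tP'[OF that(2), of "\<rho> (\<alpha> x)"] \<rho>R by simp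
  then have "(\<lambda>x. f (t x)) ` P \<inter> (\<lambda>x. f (t x)) ` (- P) = {}"
    by auto
  moreover have "large (- range (\<lambda>x. f (t x)))"
  proof -
    have "large ((\<lambda>x. f (a x)) ` R2)"
      by (rule large_inj_image[OF R12(4) inj_on_subset[OF R(2)]]) (simp add: R12(1))
    moreover have "f (a y) \<noteq> f (t x)" if "y \<in> R2" for x y
    proof (cases "x \<in> P")
      case True
      have "y \<noteq> \<rho> (\<alpha> x)" using that \<rho>R(1) R12(2) by blast
      then have "f (a y) \<noteq> f (a (\<rho> (\<alpha> x)))"
        using inj_onD[OF R(2)] that \<rho>R(2) R12(1) by (metis UnI2)
      then show ?thesis using tP[OF True] by simp
    next
      case False
      have "y \<in> R" using that R12(1) by simp
      then show ?thesis using tP'[OF False] by metis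
    qed
    then have "(\<lambda>x. f (a x)) ` R2 \<subseteq> - range (\<lambda>x. f (t x))"
      by auto
    ultimately show ?thesis using small_mono by blast
  qed
  ultimately show thesis
    using that[OF M P] by blast
qed

text \<open>A permutation carries \<open>- Y\<close> onto \<open>P\<close>, where \<open>g\<close>
  is injective and \<open>r\<close> can be decoded; all other values of \<open>g\<close> are decoded
  to \<open>c\<close>. The half \<open>Z\<close> of the fibre keeps \<open>- Y\<close> large enough
  to match \<open>P\<close>.\<close>

lemma large_fibre_subset_M:
  assumes g: "g \<in> M" "large P" "large (- P)" "inj_on g P" "g ` P \<inter> g ` (- P) = {}"
    "large (- range g)"
  shows "large_fibre \<subseteq> M"
proof
  fix r :: "'a \<Rightarrow> 'a" assume "r \<in> large_fibre"
  then obtain c where "large (r -` {c})" by (auto simp: large_fibre_def)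
  then obtain Y Z where YZ: "r -` {c} = Y \<union> Z" "Y \<inter> Z = {}" "large Y" "large Z"
    using split_large by blast
  have "Z \<subseteq> - Y" using YZ(2) by blast
  then have "large (- Y)" using YZ(4) small_mono by blast
  then obtain \<alpha> where \<alpha>: "bij_betw \<alpha> (- Y) P" using bij_betw_large g(2) by blast
  have "large (- (- Y))" using YZ(3) by simp
  from extend_bij_betw[OF \<alpha> this g(3)]
  obtain \<pi> where \<pi>: "bij \<pi>" "\<forall>x\<in>- Y. \<pi> x = \<alpha> x" by blast
  have \<pi>Y: "\<pi> x \<in> P \<longleftrightarrow> x \<notin> Y" for x
  proof
    assume "\<pi> x \<in> P"
    then obtain x' where "x' \<notin> Y" "\<pi> x = \<alpha> x'" using \<alpha> by (auto simp: bij_betw_def)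
    then have "\<pi> x = \<pi> x'" using \<pi>(2) by simp
    then have "x = x'" using \<pi>(1) by (auto simp: bij_def inj_def)
    with \<open>x' \<notin> Y\<close> show "x \<notin> Y" by simp
  next
    assume "x \<notin> Y"
    then show "\<pi> x \<in> P" using \<pi>(2) \<alpha> by (auto simp: bij_betw_def)
  qed
  define k where "k y = (if y \<in> g ` P then r (inv \<pi> (inv_into P g y)) else c)" for y
  have "k (g (\<pi> x)) = r x" for x
  proof (cases "x \<in> Y")
    case True
    then have "\<pi> x \<notin> P" using \<pi>Y by simp
    then have "g (\<pi> x) \<notin> g ` P" using g(5) by blast
    moreover have "r x = c" using True YZ(1) by auto
    ultimately show ?thesis by (simp add: k_def)
  next
    case False
    then have "\<pi> x \<in> P" using \<pi>Y by simp
    then show ?thesis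
      using g(4) \<pi>(1) by (simp add: k_def bij_is_inj)
  qed
  then have "r = (\<lambda>x. k (g x)) \<circ> \<pi>" by auto
  then show "r \<in> M"
    using M_comp M_comp_of_colarge[OF g(1,6)] M_bij \<pi>(1) by simp
qed

text \<open>Now that \<open>large_fibre\<close> lies in \<open>M\<close>, the failure of
  \<open>Pol large_fibre\<close> is used again to build an injective member of \<open>M\<close> with
  large co-range; every function factors through it from the left.\<close>

lemma M_UNIV:
  assumes h: "h \<in> M" "large (range h)" "large (- range h)"
    and U: "\<not> C \<subseteq> Pol large_fibre"
  shows "M = UNIV"
proof -
  have sub: "large_fibre \<subseteq> M"
    using M_inj_on_large[OF h U] large_fibre_subset_M by metis
  obtain n f a where f: "(n, f) \<in> C" "1 \<le> n" "\<forall>x. length (a x) = n"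
    "\<forall>i<n. (\<lambda>x. a x ! i) \<in> large_fibre" "(\<lambda>x. f (a x)) \<notin> large_fibre"
    using C_break[OF U] by blast
  have "\<forall>i. \<exists>c. i < n \<longrightarrow> large {x. a x ! i = c}"
    using f(4) by (auto simp: large_fibre_def vimage_def)
  then obtain c where c: "\<And>i. i < n \<Longrightarrow> large {x. a x ! i = c i}"
    by metis
  define Q where "Q x y \<longleftrightarrow> f (a x) = f (a y)" for x y
  have Q: "\<forall>x. small {y. Q x y}"
    using f(5) by (auto simp: Q_def large_fibre_def vimage_def eq_commute)
  have "symp Q" by (rule sympI) (simp add: Q_def)
  \<comment> \<open>Block \<open>i < n\<close> gives component \<open>i\<close> a large fibre over
    \<open>c i\<close>; block \<open>n\<close> is unconstrained and supplies the results that are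
    missed.\<close>
  define T where "T p = (if fst p < n then {x. a x ! fst p = c (fst p)} else UNIV)" for p :: "nat \<times> 'a"
  have T: "\<forall>p. large (T p)" using c by (simp add: T_def)
  obtain e :: "nat \<times> 'a \<Rightarrow> 'a" where e: "inj e" using ex_inj_nat_times .
  from large_nonconflicting_choice[OF e T Q \<open>symp Q\<close>]
  obtain s where s: "\<forall>p. s p \<in> T p" "\<forall>p q. p \<noteq> q \<longrightarrow> \<not> Q (s p) (s q)"
    by blast
  have sD: "p = q" if "f (a (s p)) = f (a (s q))" for p q
    using s(2) that unfolding Q_def by blast
  define S where "S = {p :: nat \<times> 'a. fst p < n}"
  have inj0: "inj (\<lambda>y. s (j, y))" for j
    by (rule injI) (metis Pair_inject sD)
  have "large (range (\<lambda>y. s (0, y)))"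
    by (rule large_inj_image[OF large_UNIV inj0])
  moreover have "range (\<lambda>y. s (0, y)) \<subseteq> s ` S"
    using f(2) by (auto simp: S_def)
  ultimately have "large (s ` S)" using small_mono by blast
  then obtain k where k: "bij_betw k (UNIV :: 'a set) (s ` S)" using large_surj by blast
  have "(\<lambda>x. a (k x) ! i) \<in> M" if i: "i < n" for i
  proof -
    have "large (range (\<lambda>y. s (i, y)))"
      by (rule large_inj_image[OF large_UNIV inj0])
    then have "large (k -` range (\<lambda>y. s (i, y)) \<inter> UNIV)"
    proof (rule large_vimage)
      show "range (\<lambda>y. s (i, y)) \<subseteq> range k"
        using i bij_betw_imp_surj_on[OF k] by (auto simp: S_def)
    qed
    moreover have "k -` range (\<lambda>y. s (i, y)) \<inter> UNIV \<subseteq> (\<lambda>x. a (k x) ! i) -` {c i}"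
    proof
      fix x assume "x \<in> k -` range (\<lambda>y. s (i, y)) \<inter> UNIV"
      then obtain y where "k x = s (i, y)" by auto
      then show "x \<in> (\<lambda>x. a (k x) ! i) -` {c i}"
        using s(1)[rule_format, of "(i, y)"] i by (simp add: T_def)
    qed
    ultimately have "large ((\<lambda>x. a (k x) ! i) -` {c i})" using small_mono by blast
    then show ?thesis using sub by (auto simp: large_fibre_def)
  qed
  then have M: "(\<lambda>x. f (a (k x))) \<in> M"
    using C_apply[OF f(1), of "\<lambda>x. a (k x)"] f(3) by blast
  have inj: "inj (\<lambda>x. f (a (k x)))"
  proof (rule injI)
    fix x y assume eq: "f (a (k x)) = f (a (k y))"
    have "k x \<in> s ` S" "k y \<in> s ` S" using k by (auto simp: bij_betw_def)
    then obtain p q where "k x = s p" "k y = s q" by blast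
    then have "k x = k y" using sD[of p q] eq by simp
    then show "x = y" using bij_betw_imp_inj_on[OF k] by (auto dest: injD)
  qed
  have "inj (\<lambda>y. f (a (s (n, y))))"
    by (rule injI) (metis Pair_inject sD)
  then have "large (range (\<lambda>y. f (a (s (n, y)))))"
    by (rule large_inj_image[OF large_UNIV])
  moreover have "range (\<lambda>y. f (a (s (n, y)))) \<subseteq> - range (\<lambda>x. f (a (k x)))"
  proof
    fix z assume "z \<in> range (\<lambda>y. f (a (s (n, y))))"
    then obtain y where y: "z = f (a (s (n, y)))" by auto
    have "z \<noteq> f (a (k x))" for x
    proof
      assume z: "z = f (a (k x))"
      have "k x \<in> s ` S" using k by (auto simp: bij_betw_def)
      then obtain p where "p \<in> S" "k x = s p" by auto
      then show False using sD[of "(n, y)" p] y z by (auto simp: S_def)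
    qed
    then show "z \<in> - range (\<lambda>x. f (a (k x)))" by auto
  qed
  ultimately have co: "large (- range (\<lambda>x. f (a (k x))))" using small_mono by blast
  have "r \<in> M" for r
    using M_comp_of_colarge[OF M co, of "\<lambda>z. r (inv (\<lambda>x. f (a (k x))) z)"]
    by (simp only: inv_f_f[OF inj])
  then show ?thesis by blast
qed

end

lemma (in perm_monoid) M_eq_UNIV:
  assumes listed: "\<And>G. G \<in> listed_monoids \<Longrightarrow> \<not> C \<subseteq> Pol G"
    and AU: "\<not> C \<subseteq> almost_unary" and U: "\<not> C \<subseteq> Pol large_fibre"
  shows "M = UNIV"
proof -
  have A: "\<not> C \<subseteq> Pol monoid_A" and B: "\<not> C \<subseteq> Pol monoid_B"
    and E: "\<not> C \<subseteq> Pol monoid_E" and F: "\<not> C \<subseteq> Pol monoid_F"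
    using listed by (auto simp: listed_monoids_def)
  have G: "\<not> C \<subseteq> Pol (monoid_G l)"
    if "Card_order l" "cone \<le>o l" "l \<le>o |UNIV :: 'a set|" for l
    using that listed by (auto simp: listed_monoids_def)
  interpret extending_monoid ty C M
    by unfold_locales (rule M_extend[OF A B G])
  obtain e where e: "e \<in> M" "large (- range e)" "\<not> (\<exists>c. e = (\<lambda>_. c))"
    using M_not_almost_surj[OF E F] .
  have "\<not> (\<forall>h\<in>M. large (- range h) \<longrightarrow> small (range h))"
    using C_almost_unary[OF M_two_valued[OF e]] AU by blast
  then show ?thesis using M_UNIV U by blast
qed

subsection \<open>Clones\<close>

lemma proj_in_all_ops: "1 \<le> n \<Longrightarrow> i < n \<Longrightarrow> proj n i \<in> all_ops"
  by (simp add: proj_def all_ops_def ops_def)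

lemma compose_op_in_all_ops: "1 \<le> m \<Longrightarrow> compose_op m f gs \<in> all_ops"
  by (simp add: compose_op_def all_ops_def ops_def)

lemma clone_Pol: "clone (Pol G)"
  unfolding clone_def
proof (intro conjI allI impI)
  show "Pol G \<subseteq> all_ops" by (auto simp: Pol_def)
next
  fix n i :: nat assume "1 \<le> n" "i < n"
  then show "proj n i \<in> Pol G"
    using proj_in_all_ops[of n i] by (simp add: proj_def Pol_iff tuples_def)
next
  fix n m f gs
  assume *: "(n, f) \<in> Pol G \<and> 1 \<le> m \<and> length gs = n \<and> (\<forall>g\<in>set gs. (m, g) \<in> Pol G)"
  have "(\<lambda>x. f (map (\<lambda>g. g (a x)) gs)) \<in> G"
    if a: "\<forall>x. length (a x) = m" "\<forall>i<m. (\<lambda>x. a x ! i) \<in> G" for a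
  proof -
    have "(\<lambda>x. map (\<lambda>g. g (a x)) gs ! i) \<in> G" if i: "i < n" for i
    proof -
      have "(m, gs ! i) \<in> Pol G" using * i by simp
      then have "(\<lambda>x. (gs ! i) (a x)) \<in> G" using a Pol_iff by blast
      then show ?thesis using * i by simp
    qed
    then show ?thesis
      using * Pol_iff[of n f G] by (auto dest!: spec[of _ "\<lambda>x. map (\<lambda>g. g (a x)) gs"])
  qed
  then show "compose_op m f gs \<in> Pol G"
    using compose_op_in_all_ops[of m f gs] * by (simp add: compose_op_def Pol_iff tuples_def)
qed

lemma unary_in_all_ops: "unary g \<in> all_ops"
  by (simp add: unary_def all_ops_def ops_def)

lemma unary_in_Pol_iff: "unary g \<in> Pol G \<longleftrightarrow> (\<forall>h\<in>G. g \<circ> h \<in> G)"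
proof
  assume L: "unary g \<in> Pol G"
  show "\<forall>h\<in>G. g \<circ> h \<in> G"
  proof
    fix h assume "h \<in> G"
    then have "(\<lambda>x. (\<lambda>xs\<in>tuples 1. g (xs ! 0)) [h x]) \<in> G"
      using L unfolding unary_def Pol_iff by (auto dest!: spec[of _ "\<lambda>x. [h x]"])
    then show "g \<circ> h \<in> G" by (simp add: tuples_def comp_def)
  qed
next
  assume R: "\<forall>h\<in>G. g \<circ> h \<in> G"
  then show "unary g \<in> Pol G"
    using unary_in_all_ops[of g] by (auto simp: unary_def Pol_iff tuples_def comp_def)
qed

lemma unary_in_Pol_submonoid: "submonoid_of_functions G \<Longrightarrow> unary g \<in> Pol G \<longleftrightarrow> g \<in> G"
  unfolding unary_in_Pol_iff submonoid_of_functions_def by (metis comp_id)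

lemma clone_compose:
  assumes "clone D" "(n, f) \<in> D" "1 \<le> m" "length gs = n" "\<forall>g\<in>set gs. (m, g) \<in> D"
  shows "compose_op m f gs \<in> D"
  using assms unfolding clone_def by blast

lemma clone_apply:
  assumes "clone D" "(n, f) \<in> D" "length gs = n" "\<forall>g\<in>set gs. unary g \<in> D"
  shows "unary (\<lambda>x. f (map (\<lambda>g. g x) gs)) \<in> D"
proof -
  have "compose_op 1 f (map (\<lambda>g. snd (unary g)) gs) \<in> D"
    using assms by (intro clone_compose[where n = n]) (auto simp: unary_def)
  moreover have "compose_op 1 f (map (\<lambda>g. snd (unary g)) gs) = unary (\<lambda>x. f (map (\<lambda>g. g x) gs))"
    by (auto simp: compose_op_def unary_def tuples_def comp_def restrict_def)
  ultimately show ?thesis by simp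
qed

lemma clone_subset_Pol:
  assumes "clone D"
  shows "D \<subseteq> Pol {g. unary g \<in> D}"
proof
  fix p assume "p \<in> D"
  moreover have "D \<subseteq> all_ops" using assms by (simp add: clone_def)
  ultimately show "p \<in> Pol {g. unary g \<in> D}"
    using clone_apply[OF assms] by (cases p) (auto simp: Pol_def subset_iff)
qed

lemma clone_comp_unary:
  assumes "clone D" "unary g \<in> D" "(m, h) \<in> D" "1 \<le> m"
  shows "(m, \<lambda>xs\<in>tuples m. g (h xs)) \<in> D"
proof -
  have "compose_op m (snd (unary g)) [h] \<in> D"
    using assms by (intro clone_compose[where n = 1]) (auto simp: unary_def)
  moreover have "compose_op m (snd (unary g)) [h] = (m, \<lambda>xs\<in>tuples m. g (h xs))"
    by (auto simp: compose_op_def unary_def tuples_def)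
  ultimately show ?thesis by simp
qed

lemma unary_comp_in_clone:
  assumes "clone D" "unary g \<in> D" "unary h \<in> D"
  shows "unary (g \<circ> h) \<in> D"
  using clone_apply[of D 1 "snd (unary g)" "[h]"] assms
  by (simp add: unary_def tuples_def comp_def)

definition binary :: "('a \<Rightarrow> 'a \<Rightarrow> 'a) \<Rightarrow> 'a operation" where
  "binary q = (2, \<lambda>xs\<in>tuples 2. q (xs ! 0) (xs ! 1))"

lemma binary_in_all_ops: "binary q \<in> all_ops"
  by (simp add: binary_def all_ops_def ops_def)

lemma binary_in_Pol_iff: "binary q \<in> Pol G \<longleftrightarrow> (\<forall>g\<in>G. \<forall>h\<in>G. (\<lambda>x. q (g x) (h x)) \<in> G)"
proof
  assume L: "binary q \<in> Pol G"
  show "\<forall>g\<in>G. \<forall>h\<in>G. (\<lambda>x. q (g x) (h x)) \<in> G"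
  proof (intro ballI)
    fix g h assume "g \<in> G" "h \<in> G"
    then have "\<forall>i<2. (\<lambda>x. [g x, h x] ! i) \<in> G"
      by (auto simp: less_2_cases_iff)
    then have "(\<lambda>x. (\<lambda>xs\<in>tuples 2. q (xs ! 0) (xs ! 1)) [g x, h x]) \<in> G"
      using L unfolding binary_def Pol_iff by (auto dest!: spec[of _ "\<lambda>x. [g x, h x]"])
    then show "(\<lambda>x. q (g x) (h x)) \<in> G" by (simp add: tuples_def)
  qed
next
  assume R: "\<forall>g\<in>G. \<forall>h\<in>G. (\<lambda>x. q (g x) (h x)) \<in> G"
  then show "binary q \<in> Pol G"
    using binary_in_all_ops[of q]
    by (auto simp: binary_def Pol_iff tuples_def numeral_2_eq_2 All_less_Suc)
qed

lemma clone_comp_binary: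
  assumes "clone D" "binary q \<in> D" "(m, g) \<in> D" "(m, h) \<in> D" "1 \<le> m"
  shows "(m, \<lambda>xs\<in>tuples m. q (g xs) (h xs)) \<in> D"
proof -
  have "compose_op m (snd (binary q)) [g, h] \<in> D"
    using assms by (intro clone_compose[where n = 2]) (auto simp: binary_def)
  moreover have "compose_op m (snd (binary q)) [g, h] = (m, \<lambda>xs\<in>tuples m. q (g xs) (h xs))"
    by (auto simp: compose_op_def binary_def tuples_def)
  ultimately show ?thesis by simp
qed

lemma unary_in_Pol_large_fibre: "unary g \<in> Pol large_fibre"
proof -
  have "large ((g \<circ> h) -` {g c})" if "large (h -` {c})" for h c
  proof -
    have "h -` {c} \<subseteq> (g \<circ> h) -` {g c}" by auto
    then show ?thesis using that small_mono by blast
  qed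
  then show ?thesis by (auto simp: unary_in_Pol_iff large_fibre_def)
qed

section \<open>The two exceptional clones, and generation by a pairing operation\<close>

context regular_universe
begin

text \<open>The coordinate that controls a composite is the one controlling the inner operation
  placed at the controlling coordinate of \<open>f\<close>; regularity bounds the resulting
  union.\<close>

lemma clone_almost_unary: "clone (almost_unary :: 'a operation set)"
  unfolding clone_def
proof (intro conjI allI impI)
  show "almost_unary \<subseteq> all_ops" by (auto simp: almost_unary_def)
next
  fix n i :: nat assume ni: "1 \<le> n" "i < n"
  have "(\<lambda>xs\<in>tuples n. xs ! i) ` {xs \<in> tuples n. xs ! i = c} \<subseteq> {c}" for c :: 'a
    by auto
  then have "small ((\<lambda>xs\<in>tuples n. xs ! i) ` {xs \<in> tuples n. xs ! i = c})" for c :: 'a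
    by (intro small_finite, rule finite_subset) simp
  then show "(proj n i :: 'a operation) \<in> almost_unary"
    using ni proj_in_all_ops[of n i] by (auto simp: almost_unary_def proj_def)
next
  fix n m and f :: "'a list \<Rightarrow> 'a" and gs :: "('a list \<Rightarrow> 'a) list"
  assume *: "(n, f) \<in> almost_unary \<and> 1 \<le> m \<and> length gs = n \<and> (\<forall>g\<in>set gs. (m, g) \<in> almost_unary)"
  then obtain k where k: "k < n" "\<And>c. small (f ` {xs \<in> tuples n. xs ! k = c})"
    by (auto simp: almost_unary_def)
  have "(m, gs ! k) \<in> almost_unary" using * k(1) by simp
  then obtain l where l: "l < m" "\<And>c. small ((gs ! k) ` {xs \<in> tuples m. xs ! l = c})"
    by (auto simp: almost_unary_def)
  let ?h = "\<lambda>xs\<in>tuples m. f (map (\<lambda>g. g xs) gs)"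
  have "small (?h ` {xs \<in> tuples m. xs ! l = c})" for c
  proof -
    have "?h ` {xs \<in> tuples m. xs ! l = c} \<subseteq>
        (\<Union>v\<in>(gs ! k) ` {xs \<in> tuples m. xs ! l = c}. f ` {xs \<in> tuples n. xs ! k = v})"
      using * k(1) by (auto simp: tuples_def intro!: imageI)
    moreover have "small (\<Union>v\<in>(gs ! k) ` {xs \<in> tuples m. xs ! l = c}. f ` {xs \<in> tuples n. xs ! k = v})"
      by (intro small_UN l(2) k(2))
    ultimately show ?thesis using small_mono by blast
  qed
  then show "compose_op m f gs \<in> almost_unary"
    using l(1) compose_op_in_all_ops[of m f gs] * by (auto simp: almost_unary_def compose_op_def)
qed

lemma unary_in_almost_unary: "unary (g :: 'a \<Rightarrow> 'a) \<in> almost_unary"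
proof -
  have "(\<lambda>xs\<in>tuples 1. g (xs ! 0)) ` {xs \<in> tuples 1. xs ! 0 = c} \<subseteq> {g c}" for c
    by auto
  then have "small ((\<lambda>xs\<in>tuples 1. g (xs ! 0)) ` {xs \<in> tuples 1. xs ! 0 = c})" for c
    by (intro small_finite, rule finite_subset) simp
  then show ?thesis
    using unary_in_all_ops[of g] by (auto simp: almost_unary_def unary_def)
qed

text \<open>Injectivity on all of X * X would be too much for \<open>monoid_E\<close> and
  \<open>monoid_F\<close>: the diagonal of an injective operation preserving either would be almost
  surjective, leaving too few values for the other pairs.\<close>

definition injective_on_square :: "('a \<Rightarrow> 'a \<Rightarrow> 'a) \<Rightarrow> 'a set \<Rightarrow> bool" where
  "injective_on_square q Z \<longleftrightarrow> large Z \<and>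
    (\<forall>x\<in>Z. \<forall>y\<in>Z. \<forall>u\<in>Z. \<forall>v\<in>Z. q x y = q u v \<longrightarrow> x = u \<and> y = v)"

lemma binary_notin_almost_unary:
  assumes "injective_on_square q Z"
  shows "binary q \<notin> almost_unary"
proof
  assume "binary q \<in> almost_unary"
  then obtain k where k: "k < 2"
    "\<And>c. small ((\<lambda>xs\<in>tuples 2. q (xs ! 0) (xs ! 1)) ` {xs \<in> tuples 2. xs ! k = c})"
    by (auto simp: almost_unary_def binary_def)
  have Z: "large Z" "\<And>x y u v. x \<in> Z \<Longrightarrow> y \<in> Z \<Longrightarrow> u \<in> Z \<Longrightarrow> v \<in> Z \<Longrightarrow> q x y = q u v \<Longrightarrow> x = u \<and> y = v"
    using assms unfolding injective_on_square_def by blast+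
  then obtain c where c: "c \<in> Z" using large_not_empty by blast
  let ?h = "if k = 0 then q c else (\<lambda>x. q x c)"
  have "inj_on ?h Z"
    using Z(2) c by (auto intro!: inj_onI split: if_splits)
  then have "large (?h ` Z)" using large_inj_image Z(1) by blast
  moreover have "?h ` Z \<subseteq> (\<lambda>xs\<in>tuples 2. q (xs ! 0) (xs ! 1)) ` {xs \<in> tuples 2. xs ! k = c}"
  proof (intro image_subsetI)
    fix x
    let ?xs = "if k = 0 then [c, x] else [x, c]"
    have "?xs \<in> {xs \<in> tuples 2. xs ! k = c}" using k(1) by (auto simp: tuples_def less_2_cases_iff)
    moreover have "?h x = (\<lambda>xs\<in>tuples 2. q (xs ! 0) (xs ! 1)) ?xs" by (simp add: tuples_def)
    ultimately show "?h x \<in> (\<lambda>xs\<in>tuples 2. q (xs ! 0) (xs ! 1)) ` {xs \<in> tuples 2. xs ! k = c}"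
      by (rule rev_image_eqI)
  qed
  ultimately show False using k(2) small_mono by blast
qed

text \<open>The two coordinates of a bijection from X to Z * Z have large fibres, but
  \<open>q\<close> applied to them is injective.\<close>

lemma binary_notin_Pol_large_fibre:
  assumes "injective_on_square q Z"
  shows "binary q \<notin> Pol large_fibre"
proof
  assume Pol: "binary q \<in> Pol large_fibre"
  have Z: "large Z" "\<And>x y u v. x \<in> Z \<Longrightarrow> y \<in> Z \<Longrightarrow> u \<in> Z \<Longrightarrow> v \<in> Z \<Longrightarrow> q x y = q u v \<Longrightarrow> x = u \<and> y = v"
    using assms unfolding injective_on_square_def by blast+
  obtain z :: "'a \<Rightarrow> 'a" where z: "bij_betw z UNIV Z" using large_surj[OF Z(1)] .
  obtain e :: "'a \<times> 'a \<Rightarrow> 'a" where e: "bij e" using ex_bij_times .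
  define g where "g x = z (fst (inv e x))" for x
  define h where "h x = z (snd (inv e x))" for x
  have inv_e: "inv e (e p) = p" for p using e by (simp add: bij_is_inj)
  have "large (g -` {z undefined})" "large (h -` {z undefined})"
  proof -
    have "large (range (\<lambda>y. e (undefined, y)))" "large (range (\<lambda>y. e (y, undefined)))"
      by (auto intro!: large_inj_image[OF large_UNIV] injI dest!: injD[OF bij_is_inj[OF e]])
    moreover have "range (\<lambda>y. e (undefined, y)) \<subseteq> g -` {z undefined}"
      "range (\<lambda>y. e (y, undefined)) \<subseteq> h -` {z undefined}"
      by (auto simp: g_def h_def inv_e)
    ultimately show "large (g -` {z undefined})" "large (h -` {z undefined})"
      using small_mono by blast+
  qed
  then have "g \<in> large_fibre" "h \<in> large_fibre" by (auto simp: large_fibre_def)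
  then have "(\<lambda>x. q (g x) (h x)) \<in> large_fibre" using Pol by (simp add: binary_in_Pol_iff)
  moreover have "inj (\<lambda>x. q (g x) (h x))"
  proof (rule injI)
    fix x y assume eq: "q (g x) (h x) = q (g y) (h y)"
    have "g u \<in> Z" "h u \<in> Z" for u using z by (auto simp: g_def h_def bij_betw_def)
    then have "g x = g y" "h x = h y" using Z(2) eq by blast+
    then have "inv e x = inv e y"
      using bij_betw_imp_inj_on[OF z] by (auto simp: g_def h_def prod_eq_iff dest: injD)
    then show "x = y" using e by (metis bij_inv_eq_iff)
  qed
  then have "finite ((\<lambda>x. q (g x) (h x)) -` {c})" for c
    by (rule finite_vimageI[OF finite.insertI[OF finite.emptyI]])
  ultimately show False using small_finite by (auto simp: large_fibre_def)
qed

text \<open>Moving values into \<open>Z\<close> and iterating \<open>q\<close> encodes a tuple,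
  entry by entry, in a single element; decoding followed by the desired operation is then
  unary.\<close>

lemma clone_generated:
  assumes D: "clone (D :: 'a operation set)" "range unary \<subseteq> D" and q: "binary q \<in> D" "injective_on_square q Z"
  shows "D = all_ops"
proof
  show "D \<subseteq> all_ops" using D(1) by (simp add: clone_def)
  have Z: "large Z" "\<And>x y u v. x \<in> Z \<Longrightarrow> y \<in> Z \<Longrightarrow> u \<in> Z \<Longrightarrow> v \<in> Z \<Longrightarrow> q x y = q u v \<Longrightarrow> x = u \<and> y = v"
    using q(2) unfolding injective_on_square_def by blast+
  obtain z :: "'a \<Rightarrow> 'a" where z: "bij_betw z UNIV Z" using large_surj[OF Z(1)] .
  have zD: "x = u \<and> y = v" if "q (z x) (z y) = q (z u) (z v)" for x y u v
  proof -
    have "z x \<in> Z" for x using z by (auto simp: bij_betw_def)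
    then have "z x = z u" "z y = z v" using Z(2) that by blast+
    then show ?thesis using bij_betw_imp_inj_on[OF z] by (auto dest: injD)
  qed
  have pr: "(m, \<lambda>xs\<in>tuples m. xs ! i) \<in> D" if "i < m" for m i
    using D(1) that unfolding clone_def by (auto simp: proj_def)
  have code: "\<exists>g. (m, g) \<in> D \<and> (\<forall>xs\<in>tuples m. \<forall>ys\<in>tuples m. g xs = g ys \<longrightarrow> take k xs = take k ys)"
    if "1 \<le> m" "k \<le> m" for m k
    using that(2)
  proof (induction k)
    case 0
    then show ?case using pr[of 0 m] that(1) by auto
  next
    case (Suc k)
    then obtain g where g: "(m, g) \<in> D"
      "\<forall>xs\<in>tuples m. \<forall>ys\<in>tuples m. g xs = g ys \<longrightarrow> take k xs = take k ys" by auto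
    define h :: "'a list \<Rightarrow> 'a" where "h = (\<lambda>xs\<in>tuples m. xs ! k)"
    have zu: "unary z \<in> D" using D(2) by auto
    define r where "r = (\<lambda>xs\<in>tuples m. q ((\<lambda>xs\<in>tuples m. z (g xs)) xs) ((\<lambda>xs\<in>tuples m. z (h xs)) xs))"
    have "(m, r) \<in> D"
      unfolding r_def using clone_comp_binary[OF D(1) q(1) clone_comp_unary[OF D(1) zu g(1)]
          clone_comp_unary[OF D(1) zu, of m h]] that(1) pr[of k m] Suc.prems by (simp add: h_def)
    moreover have "take (Suc k) xs = take (Suc k) ys"
      if "xs \<in> tuples m" "ys \<in> tuples m" "r xs = r ys" for xs ys
    proof -
      have "q (z (g xs)) (z (h xs)) = q (z (g ys)) (z (h ys))"
        using that by (simp add: r_def)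
      then have "g xs = g ys" "h xs = h ys" using zD by blast+
      then have "g xs = g ys" "xs ! k = ys ! k" using that(1,2) by (simp_all add: h_def)
      moreover have "take k xs = take k ys" using g(2) that(1,2) calculation(1) by blast
      ultimately show ?thesis
        using that(1,2) Suc.prems by (simp add: tuples_def take_Suc_conv_app_nth)
    qed
    ultimately show ?case by blast
  qed
  show "all_ops \<subseteq> D"
  proof
    fix p :: "'a operation" assume "p \<in> all_ops"
    then obtain m f where p: "p = (m, f)" "1 \<le> m" "f \<in> ops m" by (auto simp: all_ops_def)
    obtain g where g: "(m, g) \<in> D"
      "\<forall>xs\<in>tuples m. \<forall>ys\<in>tuples m. g xs = g ys \<longrightarrow> take m xs = take m ys"
      using code[OF p(2), of m] by auto
    have inj: "inj_on g (tuples m)" using g(2) by (auto simp: inj_on_def tuples_def)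
    let ?u = "\<lambda>y. f (inv_into (tuples m) g y)"
    have "(m, \<lambda>xs\<in>tuples m. ?u (g xs)) \<in> D"
      using D(2) by (intro clone_comp_unary[OF D(1) _ g(1) p(2)]) blast
    moreover have "(\<lambda>xs\<in>tuples m. ?u (g xs)) = f"
      using p(3) inj by (auto simp: ops_def PiE_def extensional_def fun_eq_iff)
    ultimately show "p \<in> D" using p(1) by simp
  qed
qed

end

subsection \<open>The listed monoids\<close>

lemma subset_of_card:
  assumes "Card_order l" "l \<le>o |S|"
  obtains B where "B \<subseteq> S" "|B| =o l"
proof -
  have "|Field l| =o l" using assms(1) by (rule card_of_Field_ordIso)
  moreover have "|Field l| \<le>o |S|"
    using calculation assms(2) ordIso_ordLeq_trans by blast
  then obtain B where "B \<subseteq> S" "|Field l| =o |B|"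
    using internalize_card_of_ordLeq2[of "Field l" S] by blast
  ultimately show thesis
    using that ordIso_transitive ordIso_symmetric by blast
qed

lemma monoid_G_cong:
  assumes "l =o l'"
  shows "monoid_G l = monoid_G l'"
proof -
  have "monoid_G k \<subseteq> monoid_G k'" if k: "k =o k'" for k k' :: "'a rel"
  proof
    fix f assume f: "f \<in> monoid_G k"
    have "k' \<le>o |UNIV - f ` (UNIV - A)|" if "|A| =o k'" for A
    proof -
      have "|A| =o k" using that ordIso_symmetric[OF k] by (rule ordIso_transitive)
      then have "k \<le>o |UNIV - f ` (UNIV - A)|" using f by (simp add: monoid_G_def)
      then show ?thesis by (rule ordIso_ordLeq_trans[OF ordIso_symmetric[OF k]])
    qed
    then show "f \<in> monoid_G k'" by (simp add: monoid_G_def)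
  qed
  then show ?thesis using assms ordIso_symmetric by blast
qed

lemma card_compl_mono:
  "l \<le>o |UNIV - S| \<Longrightarrow> T \<subseteq> S \<Longrightarrow> l \<le>o |UNIV - T|"
  using card_of_mono1[of "UNIV - S" "UNIV - T"] ordLeq_transitive by blast

lemma in_monoid_G:
  assumes "l \<le>o |- range f|"
  shows "f \<in> monoid_G l"
proof -
  have "l \<le>o |UNIV - range f|" using assms by (simp add: Compl_eq_Diff_UNIV)
  then have "l \<le>o |UNIV - f ` (UNIV - A)|" for A
    by (rule card_compl_mono) auto
  then show ?thesis by (simp add: monoid_G_def)
qed

text \<open>The values that \<open>g\<close> loses when \<open>A\<close> is deleted contain a set
  \<open>B\<close> of the same cardinality, and \<open>f\<close> is then evaluated off
  \<open>B\<close> only.\<close>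

lemma submonoid_monoid_G: "submonoid_of_functions (monoid_G l)"
  unfolding submonoid_of_functions_def
proof (intro conjI ballI)
  show "id \<in> monoid_G l"
    by (auto simp: monoid_G_def double_diff ordIso_iff_ordLeq)
next
  fix f g assume f: "f \<in> monoid_G l" and g: "g \<in> monoid_G l"
  show "f \<circ> g \<in> monoid_G l"
    unfolding monoid_G_def
  proof (intro CollectI allI impI)
    fix A :: "'a set" assume A: "|A| =o l"
    then have "l \<le>o |UNIV - g ` (UNIV - A)|" using g by (simp add: monoid_G_def)
    then have "|A| \<le>o |UNIV - g ` (UNIV - A)|" using A ordIso_ordLeq_trans by blast
    then obtain B where B: "B \<subseteq> UNIV - g ` (UNIV - A)" "|A| =o |B|"
      using internalize_card_of_ordLeq2[of A "UNIV - g ` (UNIV - A)"] by blast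
    then have "|B| =o l" using A ordIso_transitive ordIso_symmetric by blast
    then have "l \<le>o |UNIV - f ` (UNIV - B)|" using f by (simp add: monoid_G_def)
    moreover have "(f \<circ> g) ` (UNIV - A) \<subseteq> f ` (UNIV - B)" using B(1) by auto
    ultimately show "l \<le>o |UNIV - (f \<circ> g) ` (UNIV - A)|" by (rule card_compl_mono)
  qed
qed

lemma bij_in_monoid_G:
  assumes "bij f"
  shows "f \<in> monoid_G l"
  unfolding monoid_G_def
proof (intro CollectI allI impI)
  fix A :: "'a set" assume A: "|A| =o l"
  have "UNIV - f ` (UNIV - A) = f ` A"
    using assms by (simp add: image_set_diff bij_is_inj bij_is_surj double_diff)
  moreover have "|A| =o |f ` A|"
    using assms by (intro card_of_ordIsoI[of f]) (auto simp: bij_def bij_betw_def inj_def inj_on_def)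
  ultimately show "l \<le>o |UNIV - f ` (UNIV - A)|"
    using A by (metis ordIso_transitive ordIso_symmetric ordIso_iff_ordLeq)
qed

context regular_universe
begin

lemma submonoid_monoid_A: "submonoid_of_functions (monoid_A :: ('a \<Rightarrow> 'a) set)"
  unfolding submonoid_of_functions_def
proof (intro conjI ballI)
  have "small {x}" for x :: 'a by (simp add: small_finite)
  then show "id \<in> (monoid_A :: ('a \<Rightarrow> 'a) set)"
    by (simp add: monoid_A_def almost_all_def small_finite)
next
  fix f g :: "'a \<Rightarrow> 'a" assume fg: "f \<in> monoid_A" "g \<in> monoid_A"
  let ?bad = "\<lambda>f :: 'a \<Rightarrow> 'a. {y. large (f -` {y})}"
  have "?bad (f \<circ> g) \<subseteq> ?bad f \<union> f ` ?bad g"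
  proof
    fix y assume y: "y \<in> ?bad (f \<circ> g)"
    show "y \<in> ?bad f \<union> f ` ?bad g"
    proof (rule ccontr)
      assume n: "y \<notin> ?bad f \<union> f ` ?bad g"
      then have "small (\<Union>x\<in>f -` {y}. g -` {x})" by (intro small_UN) auto
      moreover have "(f \<circ> g) -` {y} = (\<Union>x\<in>f -` {y}. g -` {x})" by auto
      ultimately show False using y by simp
    qed
  qed
  moreover have "small (?bad f \<union> f ` ?bad g)"
    using fg by (intro small_Un small_image) (simp_all add: monoid_A_def almost_all_def)
  ultimately show "f \<circ> g \<in> monoid_A"
    using small_mono by (auto simp: monoid_A_def almost_all_def)
qed

lemma submonoid_monoid_B: "submonoid_of_functions (monoid_B :: ('a \<Rightarrow> 'a) set)"
  unfolding submonoid_of_functions_def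
proof (intro conjI ballI)
  show "id \<in> (monoid_B :: ('a \<Rightarrow> 'a) set)"
    by (simp add: monoid_B_def small_finite)
next
  fix f g :: "'a \<Rightarrow> 'a" assume fg: "f \<in> monoid_B" "g \<in> monoid_B"
  have "small (\<Union>x\<in>f -` {y}. g -` {x})" for y
    using fg by (intro small_UN) (simp_all add: monoid_B_def)
  moreover have "(f \<circ> g) -` {y} = (\<Union>x\<in>f -` {y}. g -` {x})" for y by auto
  ultimately show "f \<circ> g \<in> monoid_B" by (simp add: monoid_B_def)
qed

lemma almost_surj_comp:
  assumes "almost_surj f" "almost_surj (g :: 'a \<Rightarrow> 'a)"
  shows "almost_surj (f \<circ> g)"
proof -
  have "UNIV - range (f \<circ> g) \<subseteq> (UNIV - range f) \<union> f ` (UNIV - range g)" by auto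
  moreover have "small ((UNIV - range f) \<union> f ` (UNIV - range g))"
    using assms by (intro small_Un small_image) (simp_all add: almost_surj_def)
  ultimately show ?thesis unfolding almost_surj_def using small_mono by blast
qed

lemma surj_almost_surj: "surj f \<Longrightarrow> almost_surj (f :: 'a \<Rightarrow> 'a)"
  by (simp add: almost_surj_def small_finite)

lemma submonoid_monoid_E: "submonoid_of_functions (monoid_E :: ('a \<Rightarrow> 'a) set)"
  unfolding submonoid_of_functions_def monoid_E_def
  by (simp add: almost_surj_comp surj_almost_surj)

lemma submonoid_monoid_F: "submonoid_of_functions (monoid_F :: ('a \<Rightarrow> 'a) set)"
  unfolding submonoid_of_functions_def monoid_F_def
  using almost_surj_comp by (auto simp: surj_almost_surj comp_def)

lemma submonoid_listed: "G \<in> listed_monoids \<Longrightarrow> submonoid_of_functions (G :: ('a \<Rightarrow> 'a) set)"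
  unfolding listed_monoids_def
  using submonoid_monoid_A submonoid_monoid_B submonoid_monoid_E submonoid_monoid_F
    submonoid_monoid_G by auto

lemma inj_in_monoid_B: "inj f \<Longrightarrow> f \<in> (monoid_B :: ('a \<Rightarrow> 'a) set)"
  by (simp add: monoid_B_def small_finite finite_vimageI)

lemma monoid_B_subset_A: "(monoid_B :: ('a \<Rightarrow> 'a) set) \<subseteq> monoid_A"
  by (auto simp: monoid_A_def monoid_B_def almost_all_def small_finite)

lemma bij_in_listed:
  assumes "G \<in> listed_monoids" "bij (f :: 'a \<Rightarrow> 'a)"
  shows "f \<in> G"
  using assms bij_in_monoid_G[OF assms(2)] inj_in_monoid_B[of f] monoid_B_subset_A
    surj_almost_surj[of f]
  by (auto simp: listed_monoids_def monoid_E_def monoid_F_def bij_def)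

lemma not_cone_le_empty: "\<not> (cone \<le>o l \<and> l \<le>o |{} :: 'a set| )"
  using ordLeq_transitive[of cone l "|{} :: 'a set|"] card_of_empty3[of "{()}"]
  by (auto simp: cone_def)

text \<open>Both \<open>P\<close> and its complement are mapped onto X, so deleting any part of
  \<open>P\<close> loses no value; this violates \<open>monoid_G\<close> for all indices at
  once.\<close>

lemma ex_two_to_one:
  obtains f :: "'a \<Rightarrow> 'a" where "surj f" "f \<in> monoid_B"
    "\<And>l :: 'a rel. Card_order l \<Longrightarrow> cone \<le>o l \<Longrightarrow> l \<le>o |UNIV :: 'a set| \<Longrightarrow> f \<notin> monoid_G l"
proof -
  obtain P :: "'a set" where P: "large P" "large (- P)" using ex_half .
  obtain u where u: "bij_betw u P (UNIV :: 'a set)" using bij_betw_large[OF P(1) large_UNIV] .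
  obtain v where v: "bij_betw v (- P) (UNIV :: 'a set)" using bij_betw_large[OF P(2) large_UNIV] .
  define f where "f x = (if x \<in> P then u x else v x)" for x
  have onto: "f ` (- P) = UNIV"
    using bij_betw_imp_surj_on[OF v] by (simp add: f_def)
  then have "surj f" by blast
  moreover have "f -` {y} \<subseteq> {inv_into P u y, inv_into (- P) v y}" for y
    using bij_betw_inv_into_left[OF u] bij_betw_inv_into_left[OF v] by (auto simp: f_def split: if_splits)
  then have "f \<in> monoid_B"
    using small_finite finite_subset unfolding monoid_B_def by blast
  moreover have "f \<notin> monoid_G l"
    if l: "Card_order l" "cone \<le>o l" "l \<le>o |UNIV :: 'a set|" for l :: "'a rel"
  proof
    assume f: "f \<in> monoid_G l"
    have "l \<le>o |P|" using l(3) P(1) large_iff ordLeq_transitive by blast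
    then obtain A where A: "A \<subseteq> P" "|A| =o l" using subset_of_card[OF l(1)] by blast
    then have "l \<le>o |UNIV - f ` (UNIV - A)|" using f by (simp add: monoid_G_def)
    moreover have "f ` (- P) \<subseteq> f ` (UNIV - A)" using A(1) by blast
    then have "UNIV - f ` (UNIV - A) = {}" using onto by blast
    ultimately show False using not_cone_le_empty l(2) by metis
  qed
  ultimately show thesis using that by blast
qed

lemma ex_inj_colarge:
  obtains f :: "'a \<Rightarrow> 'a" where "inj f" "large (- range f)"
proof -
  obtain P :: "'a set" where P: "large P" "large (- P)" using ex_half .
  obtain u where u: "bij_betw u (UNIV :: 'a set) P" using large_surj[OF P(1)] .
  with P(2) that show thesis by (auto simp: bij_betw_def)
qed

lemma ex_all_fibres_large:
  obtains f :: "'a \<Rightarrow> 'a" where "\<And>y. large (f -` {y})" "surj f"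
proof -
  have "large ((\<lambda>x. snd (\<sigma> x)) -` {y})" for y
  proof -
    have "\<sigma> -` {(0, y)} \<subseteq> (\<lambda>x. snd (\<sigma> x)) -` {y}" by auto
    then show ?thesis using large_sigma small_mono by blast
  qed
  moreover have "surj (\<lambda>x. snd (\<sigma> x))"
    using range_comp_sigma[of snd] by (metis UNIV_I snd_conv surj_def)
  ultimately show thesis by (rule that)
qed

lemma colarge_in_monoid_G:
  assumes "large (- range f)" "l \<le>o |UNIV :: 'a set|"
  shows "(f :: 'a \<Rightarrow> 'a) \<in> monoid_G l"
  using assms in_monoid_G large_iff ordLeq_transitive by blast

lemma colarge_notin_E: "large (- range f) \<Longrightarrow> (f :: 'a \<Rightarrow> 'a) \<notin> monoid_E"
  by (simp add: monoid_E_def almost_surj_def Compl_eq_Diff_UNIV)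

lemma colarge_notin_F:
  "large (- range f) \<Longrightarrow> f x \<noteq> f y \<Longrightarrow> (f :: 'a \<Rightarrow> 'a) \<notin> monoid_F"
  by (auto simp: monoid_F_def almost_surj_def Compl_eq_Diff_UNIV)

lemma fibres_large_notin_A: "(\<And>y. large (f -` {y})) \<Longrightarrow> (f :: 'a \<Rightarrow> 'a) \<notin> monoid_A"
  by (simp add: monoid_A_def almost_all_def)

lemma ex_two_points: obtains u v :: 'a where "u \<noteq> v"
proof -
  obtain u v :: 'a where "u \<in> UNIV" "v \<in> UNIV" "u \<noteq> v"
    using infinite_UNIV by (metis UNIV_I finite.simps finite_subset insertCI subsetI)
  then show thesis using that by blast
qed

lemma listed_neq_UNIV:
  assumes "G \<in> listed_monoids"
  shows "(G :: ('a \<Rightarrow> 'a) set) \<noteq> UNIV"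
proof -
  obtain s :: "'a \<Rightarrow> 'a" where s: "surj s" "s \<in> monoid_B"
    "\<And>l :: 'a rel. Card_order l \<Longrightarrow> cone \<le>o l \<Longrightarrow> l \<le>o |UNIV :: 'a set| \<Longrightarrow> s \<notin> monoid_G l"
    using ex_two_to_one by blast
  obtain i :: "'a \<Rightarrow> 'a" where i: "inj i" "large (- range i)" using ex_inj_colarge .
  obtain t :: "'a \<Rightarrow> 'a" where t: "\<And>y. large (t -` {y})" "surj t" using ex_all_fibres_large by blast
  obtain u v :: 'a where "u \<noteq> v" using ex_two_points .
  then have "i u \<noteq> i v" using i(1) by (auto dest: injD)
  then have "i \<notin> monoid_E" "i \<notin> monoid_F" "t \<notin> monoid_A" "t \<notin> monoid_B"
    using colarge_notin_E[OF i(2)] colarge_notin_F[OF i(2)] fibres_large_notin_A[OF t(1)]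
      monoid_B_subset_A by blast+
  then show ?thesis using assms s(3) unfolding listed_monoids_def by blast
qed

lemma ex_injective_op_inj:
  obtains p :: "'a \<Rightarrow> 'a \<Rightarrow> 'a" where "\<And>x y u v. p x y = p u v \<Longrightarrow> x = u \<and> y = v"
    "large (- (range (\<lambda>(x, y). p x y)))"
proof -
  obtain i :: "'a \<Rightarrow> 'a" where i: "inj i" "large (- range i)" using ex_inj_colarge .
  obtain e :: "'a \<times> 'a \<Rightarrow> 'a" where e: "bij e" using ex_bij_times .
  have "- range i \<subseteq> - range (\<lambda>(x, y). i (e (x, y)))" by auto
  then have "large (- range (\<lambda>(x, y). i (e (x, y))))" using i(2) small_mono by blast
  moreover have "x = u \<and> y = v" if "i (e (x, y)) = i (e (u, v))" for x y u v
    using that injD[OF i(1)] injD[OF bij_is_inj[OF e]] by blast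
  ultimately show thesis using that[of "\<lambda>x y. i (e (x, y))"] by blast
qed

text \<open>By injectivity the fibres of the composite are contained in intersections of fibres of
  \<open>g\<close> and \<open>h\<close>, which settles \<open>monoid_A\<close> and
  \<open>monoid_B\<close>; the large co-range alone settles \<open>monoid_G\<close>.\<close>

lemma injective_op_in_Pol:
  fixes p :: "'a \<Rightarrow> 'a \<Rightarrow> 'a"
  assumes inj: "\<And>x y u v. p x y = p u v \<Longrightarrow> x = u \<and> y = v"
    and co: "large (- (range (\<lambda>(x, y). p x y)))"
  shows "binary p \<in> Pol monoid_A" "binary p \<in> Pol monoid_B"
    "l \<le>o |UNIV :: 'a set| \<Longrightarrow> binary p \<in> Pol (monoid_G l)"
proof -
  have fib: "(\<lambda>x. p (g x) (h x)) -` {p a b} \<subseteq> g -` {a} \<inter> h -` {b}" for g h a b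
    using inj by blast
  show "binary p \<in> Pol monoid_A"
    unfolding binary_in_Pol_iff
  proof (intro ballI)
    fix g h :: "'a \<Rightarrow> 'a" assume gh: "g \<in> monoid_A" "h \<in> monoid_A"
    let ?bad = "\<lambda>f :: 'a \<Rightarrow> 'a. {y. large (f -` {y})}"
    have "?bad (\<lambda>x. p (g x) (h x)) \<subseteq> (\<Union>a\<in>?bad g. p a ` ?bad h)"
    proof
      fix y assume "y \<in> ?bad (\<lambda>x. p (g x) (h x))"
      then have y: "large ((\<lambda>x. p (g x) (h x)) -` {y})" by simp
      then obtain x where x: "y = p (g x) (h x)" using large_not_empty by blast
      then have "large (g -` {g x} \<inter> h -` {h x})" using y x small_mono[OF fib[of g h "g x" "h x"]] by blast
      then have "large (g -` {g x})" "large (h -` {h x})" using small_mono[OF Int_lower1] small_mono[OF Int_lower2] by blast+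
      then show "y \<in> (\<Union>a\<in>?bad g. p a ` ?bad h)" using x by blast
    qed
    moreover have "small (\<Union>a\<in>?bad g. p a ` ?bad h)"
      using gh by (intro small_UN small_image) (simp_all add: monoid_A_def almost_all_def)
    ultimately show "(\<lambda>x. p (g x) (h x)) \<in> monoid_A"
      using small_mono by (auto simp: monoid_A_def almost_all_def)
  qed
  show "binary p \<in> Pol monoid_B"
    unfolding binary_in_Pol_iff
  proof (intro ballI)
    fix g h :: "'a \<Rightarrow> 'a" assume gh: "g \<in> monoid_B" "h \<in> monoid_B"
    have "small ((\<lambda>x. p (g x) (h x)) -` {y})" for y
    proof (cases "y \<in> range (\<lambda>x. p (g x) (h x))")
      case True
      then obtain x where "y = p (g x) (h x)" by blast
      then have "(\<lambda>x. p (g x) (h x)) -` {y} \<subseteq> g -` {g x}"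
        using fib[of g h "g x" "h x"] by simp
      then show ?thesis using gh(1) small_mono unfolding monoid_B_def by blast
    next
      case False
      then have "(\<lambda>x. p (g x) (h x)) -` {y} = {}" by blast
      then show ?thesis by (simp only: small_finite[OF finite.emptyI])
    qed
    then show "(\<lambda>x. p (g x) (h x)) \<in> monoid_B" by (simp add: monoid_B_def)
  qed
  assume l: "l \<le>o |UNIV :: 'a set|"
  show "binary p \<in> Pol (monoid_G l)"
    unfolding binary_in_Pol_iff
  proof (intro ballI)
    fix g h :: "'a \<Rightarrow> 'a"
    have "- (range (\<lambda>(x, y). p x y)) \<subseteq> - range (\<lambda>x. p (g x) (h x))" by auto
    then have "large (- range (\<lambda>x. p (g x) (h x)))" using co small_mono by blast
    then show "(\<lambda>x. p (g x) (h x)) \<in> monoid_G l" using l by (rule colarge_in_monoid_G)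
  qed
qed

text \<open>On arguments outside \<open>Z\<close> the operation depends on one coordinate only, so that an almost
  surjective argument forces an almost surjective result, whereas on \<open>Z \<times> Z\<close> it is injective.\<close>

lemma ex_injective_on_square_E_F:
  obtains p :: "'a \<Rightarrow> 'a \<Rightarrow> 'a" and Z where "injective_on_square p Z"
    "binary p \<in> Pol monoid_E" "binary p \<in> Pol monoid_F"
proof -
  obtain q :: "'a \<Rightarrow> 'a \<Rightarrow> 'a" where q: "\<And>x y u v. q x y = q u v \<Longrightarrow> x = u \<and> y = v"
    using ex_injective_op_inj by metis
  obtain Z :: "'a set" where Z: "large Z" "large (- Z)" using ex_half .
  obtain w where w: "bij_betw w (- Z) (UNIV :: 'a set)" using bij_betw_large[OF Z(2) large_UNIV] .
  define p where "p x y = (if x \<notin> Z then w x else if y \<notin> Z then w y else q x y)" for x y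
  have "p x y = q x y" if "x \<in> Z" "y \<in> Z" for x y
    using that by (simp add: p_def)
  then have sq: "injective_on_square p Z"
    unfolding injective_on_square_def using Z(1) q by metis
  \<comment> \<open>\<open>w\<close> maps the complement of \<open>Z\<close> onto X, so a value
    missed by \<open>r\<close> is the \<open>w\<close>-image of a point missed by
    \<open>g\<close>.\<close>
  have as: "almost_surj r" if g: "almost_surj g" and r: "\<And>x. g x \<notin> Z \<Longrightarrow> r x = w (g x)" for r g :: "'a \<Rightarrow> 'a"
  proof -
    have "UNIV - range r \<subseteq> w ` (UNIV - range g)"
    proof
      fix y assume y: "y \<in> UNIV - range r"
      obtain z where z: "z \<notin> Z" "y = w z" using bij_betw_imp_surj_on[OF w] by blast
      have "z \<noteq> g x" for x
      proof
        assume "z = g x"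
        then have "y = r x" using z r[of x] by simp
        then show False using y by blast
      qed
      then have "z \<notin> range g" by blast
      then show "y \<in> w ` (UNIV - range g)" using z by blast
    qed
    then show ?thesis using g small_image small_mono unfolding almost_surj_def by blast
  qed
  have l: "almost_surj (\<lambda>x. p (g x) (h x))" if "almost_surj g" for g h
    by (rule as[OF that]) (simp add: p_def)
  have "binary p \<in> Pol monoid_E"
    unfolding binary_in_Pol_iff monoid_E_def using l by simp
  moreover have "binary p \<in> Pol monoid_F"
    unfolding binary_in_Pol_iff
  proof (intro ballI)
    fix g h :: "'a \<Rightarrow> 'a" assume gh: "g \<in> monoid_F" "h \<in> monoid_F"
    show "(\<lambda>x. p (g x) (h x)) \<in> monoid_F"
    proof (cases "almost_surj g")
      case True
      then show ?thesis using l by (simp add: monoid_F_def)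
    next
      case False
      then obtain c where c: "g = (\<lambda>_. c)" using gh(1) by (auto simp: monoid_F_def)
      show ?thesis
      proof (cases "c \<in> Z \<and> almost_surj h")
        case True
        have "almost_surj (\<lambda>x. p (g x) (h x))"
          by (rule as[of h]) (use True in \<open>simp_all add: c p_def\<close>)
        then show ?thesis by (simp add: monoid_F_def)
      next
        case False
        then have "c \<notin> Z \<or> (\<exists>d. h = (\<lambda>_. d))" using gh(2) by (auto simp: monoid_F_def)
        then have "\<exists>d. (\<lambda>x. p (g x) (h x)) = (\<lambda>_. d)" by (auto simp: c p_def)
        then show ?thesis by (simp add: monoid_F_def)
      qed
    qed
  qed
  ultimately show thesis using that sq by blast
qed

lemma listed_ex_injective_on_square:
  assumes "G \<in> listed_monoids"
  obtains p :: "'a \<Rightarrow> 'a \<Rightarrow> 'a" and Z where "injective_on_square p Z" "binary p \<in> Pol G"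
proof -
  obtain q :: "'a \<Rightarrow> 'a \<Rightarrow> 'a" where q: "\<And>x y u v. q x y = q u v \<Longrightarrow> x = u \<and> y = v"
    "large (- (range (\<lambda>(x, y). q x y)))"
    using ex_injective_op_inj by blast
  have "injective_on_square q UNIV"
    unfolding injective_on_square_def using q(1) large_UNIV by blast
  moreover note injective_op_in_Pol[OF q]
  moreover obtain p :: "'a \<Rightarrow> 'a \<Rightarrow> 'a" and Z where "injective_on_square p Z"
    "binary p \<in> Pol monoid_E" "binary p \<in> Pol monoid_F"
    using ex_injective_on_square_E_F .
  ultimately show thesis
    using that assms unfolding listed_monoids_def by blast
qed

section \<open>Incomparability of the clones \<open>Pol G\<close>\<close>

text \<open>Since \<open>monoid_B\<close> is contained in \<open>monoid_A\<close>, unary operations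
  cannot separate them. The constant \<open>c\<close> is available only in \<open>monoid_A\<close>;
  freezing the first argument of \<open>p\<close> at \<open>c\<close> exposes \<open>t\<close>,
  while for arguments in \<open>monoid_B\<close> the value \<open>c\<close> is attained on a small
  set only.\<close>

lemma Pol_B_not_subset_Pol_A: "\<not> (Pol monoid_B :: 'a operation set) \<subseteq> Pol monoid_A"
proof
  assume sub: "(Pol monoid_B :: 'a operation set) \<subseteq> Pol monoid_A"
  obtain q :: "'a \<Rightarrow> 'a \<Rightarrow> 'a" where q: "\<And>x y u v. q x y = q u v \<Longrightarrow> x = u \<and> y = v"
    using ex_injective_op_inj by metis
  obtain t :: "'a \<Rightarrow> 'a" where t: "\<And>y. large (t -` {y})" "surj t" using ex_all_fibres_large by blast
  define c :: 'a where "c = undefined"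
  define p where "p x y = (if x = c then t y else q x y)" for x y
  have "binary p \<in> Pol monoid_B"
    unfolding binary_in_Pol_iff
  proof (intro ballI)
    fix g h :: "'a \<Rightarrow> 'a" assume gh: "g \<in> monoid_B" "h \<in> monoid_B"
    have "small ((\<lambda>x. p (g x) (h x)) -` {z})" for z
    proof -
      obtain a where a: "\<And>x y. q x y = z \<Longrightarrow> x = a" using q by metis
      have "(\<lambda>x. p (g x) (h x)) -` {z} \<subseteq> g -` {c} \<union> g -` {a}"
        using a by (auto simp: p_def split: if_splits)
      moreover have "small (g -` {c} \<union> g -` {a})"
        using gh(1) by (intro small_Un) (simp_all add: monoid_B_def)
      ultimately show ?thesis using small_mono by blast
    qed
    then show "(\<lambda>x. p (g x) (h x)) \<in> monoid_B" by (simp add: monoid_B_def)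
  qed
  then have p: "\<forall>g\<in>monoid_A. \<forall>h\<in>monoid_A. (\<lambda>x. p (g x) (h x)) \<in> monoid_A"
    using sub binary_in_Pol_iff by blast
  have c:  "(\<lambda>_ :: 'a. c) \<in> monoid_A"
  proof -
    have "{y. large ((\<lambda>_ :: 'a. c) -` {y})} \<subseteq> {c}"
      using small_finite by (auto simp: vimage_def)
    then have "small {y. large ((\<lambda>_ :: 'a. c) -` {y})}"
      by (intro small_finite, rule finite_subset) simp
    then show ?thesis by (simp add: monoid_A_def almost_all_def)
  qed
  have "(\<lambda>x. x) \<in> (monoid_A :: ('a \<Rightarrow> 'a) set)"
    using submonoid_monoid_A by (simp add: submonoid_of_functions_def id_def)
  from p[THEN bspec, OF c, THEN bspec, OF this] have "(\<lambda>x. p c x) \<in> monoid_A" .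
  then have "t \<in> monoid_A" by (simp add: p_def[abs_def])
  then show False using fibres_large_notin_A[OF t(1)] by blast
qed

text \<open>Again the smaller monoid lacks the constants: the constant \<open>u\<close> exposes the
  injection \<open>i\<close>, whereas for almost surjective \<open>g\<close> the detour at
  \<open>u\<close> costs at most the value \<open>u\<close>.\<close>

lemma Pol_E_not_subset_Pol_F: "\<not> (Pol monoid_E :: 'a operation set) \<subseteq> Pol monoid_F"
proof
  assume sub: "(Pol monoid_E :: 'a operation set) \<subseteq> Pol monoid_F"
  obtain i :: "'a \<Rightarrow> 'a" where i: "inj i" "large (- range i)" using ex_inj_colarge .
  obtain u v :: 'a where uv: "u \<noteq> v" using ex_two_points .
  define p where "p x y = (if x = u then i y else x)" for x y
  have "binary p \<in> Pol monoid_E"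
    unfolding binary_in_Pol_iff
  proof (intro ballI)
    fix g h :: "'a \<Rightarrow> 'a" assume gh: "g \<in> monoid_E" "h \<in> monoid_E"
    have "UNIV - range (\<lambda>x. p (g x) (h x)) \<subseteq> (UNIV - range g) \<union> {u}"
    proof
      fix y assume y: "y \<in> UNIV - range (\<lambda>x. p (g x) (h x))"
      have "y = u" if "y = g x" for x
      proof (rule ccontr)
        assume "y \<noteq> u"
        then have "p (g x) (h x) = y" using that by (simp add: p_def)
        then show False using y by blast
      qed
      then show "y \<in> (UNIV - range g) \<union> {u}" by blast
    qed
    moreover have "small ((UNIV - range g) \<union> {u})"
      using gh(1) by (intro small_Un) (simp_all add: monoid_E_def almost_surj_def small_finite)
    ultimately show "(\<lambda>x. p (g x) (h x)) \<in> monoid_E"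
      using small_mono unfolding monoid_E_def almost_surj_def by blast
  qed
  then have p: "\<forall>g\<in>monoid_F. \<forall>h\<in>monoid_F. (\<lambda>x. p (g x) (h x)) \<in> monoid_F"
    using sub binary_in_Pol_iff by blast
  have c:  "(\<lambda>_. u) \<in> monoid_F" by (auto simp: monoid_F_def)
  have "(\<lambda>x. x) \<in> (monoid_F :: ('a \<Rightarrow> 'a) set)"
    using submonoid_monoid_F by (simp add: submonoid_of_functions_def id_def)
  from p[THEN bspec, OF c, THEN bspec, OF this] have "(\<lambda>x. p u x) \<in> monoid_F" .
  then have "i \<in> monoid_F" by (simp add: p_def[abs_def])
  then show False using colarge_notin_F[OF i(2), of u v] uv i(1) by (auto dest: injD)
qed

text \<open>A function that misses exactly \<open>l\<close> points and is constant on a large set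
  \<open>P\<close>, the rest being covered from outside \<open>P\<close>: deleting \<open>k\<close>
  points of \<open>P\<close> loses nothing more.\<close>

lemma monoid_G_not_subset:
  assumes l: "Card_order l" "l \<le>o |UNIV :: 'a set|"
    and k: "Card_order k" "k \<le>o |UNIV :: 'a set|"
    and lk: "l <o (k :: 'a rel)"
  shows "\<not> monoid_G l \<subseteq> (monoid_G k :: ('a \<Rightarrow> 'a) set)"
proof
  assume sub: "monoid_G l \<subseteq> (monoid_G k :: ('a \<Rightarrow> 'a) set)"
  obtain N :: "'a set" where N: "|N| =o l" using subset_of_card[OF l] by blast
  have "|N| <o |UNIV :: 'a set|"
    using ordIso_ordLess_trans[OF N] ordLess_ordLeq_trans[OF lk k(2)] by blast
  then have "large (- N)" using large_Compl_small by (simp add: small_def)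
  obtain P :: "'a set" where P: "large P" "large (- P)" using ex_half .
  obtain w where w: "bij_betw w (- P) (- N)" using bij_betw_large[OF P(2) \<open>large (- N)\<close>] .
  obtain c where c: "c \<in> - N" using large_not_empty[OF \<open>large (- N)\<close>] by blast
  define f where "f x = (if x \<in> P then c else w x)" for x
  have onto: "f ` (- P) = - N" using bij_betw_imp_surj_on[OF w] by (simp add: f_def)
  have "range f \<subseteq> - N" using onto c by (auto simp: f_def split: if_splits)
  then have "N \<subseteq> - range f" by blast
  then have "l \<le>o |- range f|"
    using ordIso_ordLeq_trans[OF ordIso_symmetric[OF N] card_of_mono1] by blast
  then have "f \<in> monoid_G l" by (rule in_monoid_G)
  then have "f \<in> monoid_G k" using sub by blast
  have "k \<le>o |P|" using k(2) P(1) large_iff ordLeq_transitive by blast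
  then obtain A where A: "A \<subseteq> P" "|A| =o k" using subset_of_card[OF k(1)] by blast
  have "k \<le>o |UNIV - f ` (UNIV - A)|" using \<open>f \<in> monoid_G k\<close> A(2) by (simp add: monoid_G_def)
  moreover have "f ` (- P) \<subseteq> f ` (UNIV - A)" using A(1) by blast
  then have "UNIV - f ` (UNIV - A) \<subseteq> N" using onto by blast
  ultimately have "k \<le>o |N|" using card_of_mono1 ordLeq_transitive by blast
  then have "k \<le>o l" using N ordLeq_ordIso_trans by blast
  then show False using lk not_ordLess_ordLeq by blast
qed

text \<open>The operation maps the square of the complement of a set of cardinality \<open>k\<close> bijectively onto
  \<open>X\<close>. A member \<open>g\<close> of \<open>monoid_G l\<close> that misses at most \<open>k < l\<close> points has only small fibres, so in any
  case the curve \<open>(g, h)\<close> meets some column of the square in a small set.\<close>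

lemma Pol_G_not_subset:
  assumes l: "Card_order l" "l \<le>o |UNIV :: 'a set|"
    and k: "Card_order k" "cone \<le>o k" "k \<le>o |UNIV :: 'a set|"
    and kl: "k <o (l :: 'a rel)"
  shows "\<not> Pol (monoid_G l) \<subseteq> (Pol (monoid_G k) :: 'a operation set)"
proof
  assume sub: "Pol (monoid_G l) \<subseteq> (Pol (monoid_G k) :: 'a operation set)"
  obtain N :: "'a set" where N: "|N| =o k" using subset_of_card[OF k(1,3)] by blast
  have "|N| <o |UNIV :: 'a set|"
    using ordIso_ordLess_trans[OF N] ordLess_ordLeq_trans[OF kl l(2)] by blast
  then have coN: "large (- N)" using large_Compl_small by (simp add: small_def)
  obtain j where j: "bij_betw j (- N) (UNIV :: 'a set)" using bij_betw_large[OF coN large_UNIV] .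
  have jD: "x = y" if "j x = j y" "x \<notin> N" "y \<notin> N" for x y
    using bij_betw_imp_inj_on[OF j] that by (auto dest: inj_onD)
  obtain e :: "'a \<times> 'a \<Rightarrow> 'a" where e: "bij e" using ex_bij_times .
  note eD = injD[OF bij_is_inj[OF e]]
  define d :: 'a where "d = undefined"
  define p where "p x y = (if x \<in> N \<or> y \<in> N then d else e (j x, j y))" for x y
  have "binary p \<in> Pol (monoid_G l)"
    unfolding binary_in_Pol_iff
  proof (intro ballI)
    fix g h :: "'a \<Rightarrow> 'a" assume g: "g \<in> monoid_G l" and "h \<in> monoid_G l"
    have "\<exists>c. c \<notin> N \<and> small (g -` {c})"
    proof (cases "- N \<subseteq> range g")
      case False
      then obtain c where "c \<notin> N" "g -` {c} = {}" by auto
      then show ?thesis using small_finite by (metis finite.emptyI)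
    next
      case True
      have "small (g -` {c})" for c
      proof (rule ccontr)
        assume "large (g -` {c})"
        then obtain Y Z where YZ: "g -` {c} = Y \<union> Z" "Y \<inter> Z = {}" "large Y" "large Z"
          using split_large by blast
        have "l \<le>o |Y|" using l(2) YZ(3) large_iff ordLeq_transitive by blast
        then obtain A where A: "A \<subseteq> Y" "|A| =o l" using subset_of_card[OF l(1)] by blast
        obtain z where z: "z \<in> Z" using large_not_empty[OF YZ(4)] by blast
        have "range g \<subseteq> g ` (UNIV - A)"
        proof (intro image_subsetI)
          fix x
          show "g x \<in> g ` (UNIV - A)"
          proof (cases "x \<in> A")
            case True
            then have "x \<in> g -` {c}" "z \<in> g -` {c}" using A(1) YZ(1) z by blast+
            then have "g x = g z" by simp
            moreover have "z \<notin> A" using A(1) YZ(2) z by auto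
            ultimately show ?thesis by blast
          qed blast
        qed
        then have "UNIV - g ` (UNIV - A) \<subseteq> N" using True by blast
        moreover have "l \<le>o |UNIV - g ` (UNIV - A)|" using g A(2) by (simp add: monoid_G_def)
        ultimately have "l \<le>o |N|" using card_of_mono1 ordLeq_transitive by blast
        then have "l \<le>o k" using N ordLeq_ordIso_trans by blast
        then show False using kl not_ordLess_ordLeq by blast
      qed
      then show ?thesis using large_not_empty[OF coN] by blast
    qed
    then obtain c where c: "c \<notin> N" "small (g -` {c})" by blast
    let ?r = "\<lambda>x. p (g x) (h x)"
    \<comment> \<open>Apart from \<open>d\<close>, points in the column of \<open>c\<close> arise
      only from arguments with \<open>g x = c\<close>, which are few.\<close>
    have "range (\<lambda>y. e (j c, y)) - insert d (?r ` (g -` {c})) \<subseteq> - range ?r"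
    proof
      fix z assume "z \<in> range (\<lambda>y. e (j c, y)) - insert d (?r ` (g -` {c}))"
      then obtain y where z: "z = e (j c, y)" "z \<noteq> d" "z \<notin> ?r ` (g -` {c})" by blast
      have "z \<noteq> ?r x" for x
      proof
        assume zx: "z = ?r x"
        then have "g x \<notin> N" "e (j c, y) = e (j (g x), j (h x))"
          using z(1,2) by (auto simp: p_def split: if_splits)
        then have "c = g x" using jD[of c "g x"] eD c(1) by blast
        then show False using z(3) zx by blast
      qed
      then show "z \<in> - range ?r" by blast
    qed
    moreover have "large (range (\<lambda>y. e (j c, y)))"
      by (rule large_inj_image[OF large_UNIV]) (auto intro!: injI dest: eD)
    moreover have "small (insert d (?r ` (g -` {c})))"
      using small_Un[OF small_finite[of "{d}"] small_image[OF c(2), of ?r]] by simp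
    ultimately have "large (- range ?r)" using large_Diff small_mono by blast
    then show "?r \<in> monoid_G l" using l(2) by (rule colarge_in_monoid_G)
  qed
  then have pk: "binary p \<in> Pol (monoid_G k)" using sub by blast
  obtain P :: "'a set" where P: "large P" "large (- P)" using ex_half .
  obtain \<tau> where \<tau>: "bij_betw \<tau> (- P) (UNIV :: 'a set)" using bij_betw_large[OF P(2) large_UNIV] .
  \<comment> \<open>\<open>g\<close> and \<open>h\<close> avoid \<open>N\<close>, so they miss
    \<open>k\<close> points, yet \<open>p\<close> recombines them to \<open>\<tau>\<close>, which is
    onto even after all of \<open>P\<close> is deleted.\<close>
  define g where "g x = inv_into (- N) j (fst (inv e (\<tau> x)))" for x
  define h where "h x = inv_into (- N) j (snd (inv e (\<tau> x)))" for x
  have jN: "inv_into (- N) j y \<in> - N" "j (inv_into (- N) j y) = y" for y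
    using inv_into_into[of y j "- N"] f_inv_into_f[of y j "- N"] bij_betw_imp_surj_on[OF j]
    by simp_all
  have "r \<in> monoid_G k" if "\<And>x. r x \<notin> N" for r :: "'a \<Rightarrow> 'a"
  proof (rule in_monoid_G)
    have "N \<subseteq> - range r" using that by blast
    then show "k \<le>o |- range r|"
      using ordIso_ordLeq_trans[OF ordIso_symmetric[OF N] card_of_mono1] by blast
  qed
  then have "g \<in> monoid_G k" "h \<in> monoid_G k" using jN(1) by (auto simp: g_def h_def)
  then have "(\<lambda>x. p (g x) (h x)) \<in> monoid_G k" using pk by (simp add: binary_in_Pol_iff)
  moreover have "p (g x) (h x) = \<tau> x" for x
    using jN e by (simp add: p_def g_def h_def bij_is_surj surj_f_inv_f)
  ultimately have \<tau>k: "\<tau> \<in> monoid_G k" by simp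
  have "k \<le>o |P|" using k(3) P(1) large_iff ordLeq_transitive by blast
  then obtain A where A: "A \<subseteq> P" "|A| =o k" using subset_of_card[OF k(1)] by blast
  have "k \<le>o |UNIV - \<tau> ` (UNIV - A)|" using \<tau>k A(2) by (simp add: monoid_G_def)
  moreover have "\<tau> ` (- P) \<subseteq> \<tau> ` (UNIV - A)" using A(1) by blast
  then have "UNIV - \<tau> ` (UNIV - A) = {}" using bij_betw_imp_surj_on[OF \<tau>] by blast
  ultimately show False using not_cone_le_empty k(2) by metis
qed

text \<open>Passing to unary parts gives \<open>G \<subseteq> H\<close>, and the test functions
  \<open>s\<close>, \<open>i\<close>, \<open>t\<close>, a constant and \<open>i \<circ> t\<close>
  refute this for most pairs. The pairs B, A and E, F, and two monoids \<open>monoid_G\<close> with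
  different cardinals, are covered by the separate lemmas.\<close>

lemma Pol_subset_imp_eq:
  assumes G: "G \<in> listed_monoids" and H: "H \<in> (listed_monoids :: ('a \<Rightarrow> 'a) set set)"
    and sub: "Pol G \<subseteq> Pol H"
  shows "G = H"
proof -
  have le: "G \<subseteq> H"
    using sub unary_in_Pol_submonoid[OF submonoid_listed[OF G]]
      unary_in_Pol_submonoid[OF submonoid_listed[OF H]] by blast
  obtain s :: "'a \<Rightarrow> 'a" where s: "surj s" "s \<in> monoid_B"
    "\<And>l :: 'a rel. Card_order l \<Longrightarrow> cone \<le>o l \<Longrightarrow> l \<le>o |UNIV :: 'a set| \<Longrightarrow> s \<notin> monoid_G l"
    using ex_two_to_one by blast
  obtain i :: "'a \<Rightarrow> 'a" where i: "inj i" "large (- range i)" using ex_inj_colarge .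
  obtain t :: "'a \<Rightarrow> 'a" where t: "\<And>y. large (t -` {y})" "surj t" using ex_all_fibres_large by blast
  obtain u v :: 'a where uv: "u \<noteq> v" using ex_two_points .
  let ?c = "\<lambda>_ :: 'a. u"
  have sI: "s \<in> monoid_A" "s \<in> monoid_E" "s \<in> monoid_F"
    using s(1,2) monoid_B_subset_A surj_almost_surj by (auto simp: monoid_E_def monoid_F_def)
  have iI: "i \<in> monoid_A" "i \<in> monoid_B" "i \<notin> monoid_E" "i \<notin> monoid_F"
    using inj_in_monoid_B[OF i(1)] monoid_B_subset_A colarge_notin_E[OF i(2)]
      colarge_notin_F[OF i(2), of u v] uv i(1) by (auto dest: injD)
  have tI: "t \<in> monoid_E" "t \<in> monoid_F" "t \<notin> monoid_A" "t \<notin> monoid_B"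
    using t surj_almost_surj fibres_large_notin_A[OF t(1)] monoid_B_subset_A
    by (auto simp: monoid_E_def monoid_F_def)
  have cI: "?c \<in> monoid_A" "?c \<in> monoid_F" "?c \<notin> monoid_B" "?c \<notin> monoid_E"
  proof -
    have "{y. large (?c -` {y})} \<subseteq> {u}"
      using small_finite by (auto simp: vimage_def)
    then have "small {y. large (?c -` {y})}"
      by (intro small_finite, rule finite_subset) simp
    then show "?c \<in> monoid_A" by (simp add: monoid_A_def almost_all_def)
    show "?c \<in> monoid_F" by (auto simp: monoid_F_def)
    have "large (?c -` {u})" by (simp add: vimage_def)
    then show "?c \<notin> monoid_B" unfolding monoid_B_def by blast
    have "large (- {u})" by (rule large_Compl_small) (simp add: small_finite)
    then show "?c \<notin> monoid_E" by (intro colarge_notin_E) simp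
  qed
  have it: "i \<circ> t \<notin> monoid_A" "i \<circ> t \<notin> monoid_B" "i \<circ> t \<notin> monoid_E" "i \<circ> t \<notin> monoid_F"
    "l \<le>o |UNIV :: 'a set| \<Longrightarrow> i \<circ> t \<in> monoid_G l" for l
  proof -
    have r: "range (i \<circ> t) = range i" using t(2) by (metis fun.set_map)
    then have co: "large (- range (i \<circ> t))" using i(2) by simp
    have "large ((i \<circ> t) -` {i y})" for y
    proof -
      have "t -` {y} \<subseteq> (i \<circ> t) -` {i y}" by auto
      then show ?thesis using t(1) small_mono by blast
    qed
    then have "range i \<subseteq> {y. large ((i \<circ> t) -` {y})}" by blast
    moreover have "large (range i)" by (rule large_inj_image[OF large_UNIV i(1)])
    ultimately have "large {y. large ((i \<circ> t) -` {y})}" using small_mono by blast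
    then show "i \<circ> t \<notin> monoid_A" by (simp add: monoid_A_def almost_all_def)
    then show "i \<circ> t \<notin> monoid_B" using monoid_B_subset_A by blast
    show "i \<circ> t \<notin> monoid_E" using colarge_notin_E[OF co] .
    obtain x y where "t x = u" "t y = v" using t(2) by (metis surj_def)
    then have "(i \<circ> t) x \<noteq> (i \<circ> t) y" using uv i(1) by (auto dest: injD)
    then show "i \<circ> t \<notin> monoid_F" using colarge_notin_F[OF co] by blast
    show "l \<le>o |UNIV :: 'a set| \<Longrightarrow> i \<circ> t \<in> monoid_G l" using colarge_in_monoid_G[OF co] .
  qed
  from G consider "G = monoid_A" | "G = monoid_B" | "G = monoid_E" | "G = monoid_F"
    | l where "G = monoid_G l" "Card_order l" "cone \<le>o l" "l \<le>o |UNIV :: 'a set|"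
    unfolding listed_monoids_def by blast
  note Gc = this
  from H consider "H = monoid_A" | "H = monoid_B" | "H = monoid_E" | "H = monoid_F"
    | k where "H = monoid_G k" "Card_order k" "cone \<le>o k" "k \<le>o |UNIV :: 'a set|"
    unfolding listed_monoids_def by blast
  note Hc = this
  show ?thesis
  proof (cases rule: Gc)
    case 1
    with le show ?thesis by (cases rule: Hc) (use sI iI cI s(3) in blast)+
  next
    case 2
    with le sub show ?thesis
      by (cases rule: Hc) (use iI s(2,3) Pol_B_not_subset_Pol_A in blast)+
  next
    case 3
    with le sub show ?thesis
      by (cases rule: Hc) (use tI sI s(3) Pol_E_not_subset_Pol_F in blast)+
  next
    case 4
    with le show ?thesis by (cases rule: Hc) (use tI sI cI s(3) in blast)+
  next
    case (5 l)
    show ?thesis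
    proof (cases rule: Hc)
      case (5 k)
      have "Well_order l" "Well_order k"
        using \<open>Card_order l\<close> \<open>Card_order k\<close> by (auto simp: card_order_on_well_order_on)
      then consider "l <o k" | "k <o l" | "l =o k"
        using ordLess_or_ordLeq ordLeq_iff_ordLess_or_ordIso ordIso_symmetric by blast
      then show ?thesis
      proof cases
        case 1
        then show ?thesis using monoid_G_not_subset[of l k] 5 \<open>G = monoid_G l\<close> \<open>Card_order l\<close>
            \<open>l \<le>o |UNIV :: 'a set|\<close> le by blast
      next
        case 2
        then show ?thesis using Pol_G_not_subset[of l k] 5 \<open>G = monoid_G l\<close> \<open>Card_order l\<close>
            \<open>l \<le>o |UNIV :: 'a set|\<close> sub by blast
      next
        case 3
        then show ?thesis using monoid_G_cong 5(1) \<open>G = monoid_G l\<close> by simp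
      qed
    qed (use 5 it le in blast)+
  qed
qed

section \<open>Maximality and completeness of the list\<close>

lemma clone_perm_monoid:
  assumes "clone D" "\<And>g :: 'a \<Rightarrow> 'a. bij g \<Longrightarrow> unary g \<in> D"
  shows "perm_monoid D {g. unary g \<in> D}"
proof unfold_locales
  show "D \<subseteq> all_ops" using assms(1) by (simp add: clone_def)
  show "D \<subseteq> Pol {g. unary g \<in> D}" by (rule clone_subset_Pol[OF assms(1)])
qed (use assms unary_comp_in_clone in auto)

lemma maximal_clone_subset_eq:
  assumes "maximal_clone C" "clone D" "C \<subseteq> D" "D \<noteq> all_ops"
  shows "D = C"
proof -
  have "D \<subseteq> all_ops" using assms(2) by (simp add: clone_def)
  then show ?thesis using assms unfolding maximal_clone_def by blast
qed

lemma maximal_clone_is_Pol: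
  assumes C: "maximal_clone (C :: 'a operation set)" "unary ` {g. bij g} \<subseteq> C" "\<not> range unary \<subseteq> C"
  shows "\<exists>G\<in>listed_monoids. C = Pol G"
proof (rule ccontr)
  assume n: "\<not> ?thesis"
  have cl: "clone C" using C(1) by (simp add: maximal_clone_def)
  interpret perm_monoid ty C "{g. unary g \<in> C}"
    using clone_perm_monoid[OF cl] C(2) by blast
  \<comment> \<open>\<open>q\<close> witnesses that both exceptional clones are proper, so that
    maximality would force \<open>C\<close> to equal one containing it.\<close>
  obtain q :: "'a \<Rightarrow> 'a \<Rightarrow> 'a" where q: "\<And>x y u v. q x y = q u v \<Longrightarrow> x = u \<and> y = v"
    using ex_injective_op_inj by metis
  have sq: "injective_on_square q UNIV"
    unfolding injective_on_square_def using q large_UNIV by blast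
  have "\<not> C \<subseteq> Pol G" if G: "G \<in> listed_monoids" for G
  proof
    assume "C \<subseteq> Pol G"
    moreover have "Pol G \<noteq> all_ops"
      using listed_neq_UNIV[OF G] unary_in_Pol_submonoid[OF submonoid_listed[OF G]]
        unary_in_all_ops by (metis UNIV_eq_I)
    ultimately have "Pol G = C" using maximal_clone_subset_eq[OF C(1) clone_Pol] by blast
    then show False using n G by blast
  qed
  moreover have "\<not> C \<subseteq> almost_unary"
  proof
    assume "C \<subseteq> almost_unary"
    moreover have "almost_unary \<noteq> (all_ops :: 'a operation set)"
      using binary_notin_almost_unary[OF sq] binary_in_all_ops by metis
    ultimately have "almost_unary = C"
      using maximal_clone_subset_eq[OF C(1) clone_almost_unary] by blast
    then show False using C(3) unary_in_almost_unary by blast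
  qed
  moreover have "\<not> C \<subseteq> Pol large_fibre"
  proof
    assume "C \<subseteq> Pol large_fibre"
    moreover have "Pol large_fibre \<noteq> (all_ops :: 'a operation set)"
      using binary_notin_Pol_large_fibre[OF sq] binary_in_all_ops by metis
    ultimately have "Pol large_fibre = C"
      using maximal_clone_subset_eq[OF C(1) clone_Pol] by blast
    then show False using C(3) unary_in_Pol_large_fibre by blast
  qed
  ultimately have "{g. unary g \<in> C} = UNIV" by (rule M_eq_UNIV)
  then show False using C(3) by blast
qed

lemma maximal_clone_Pol:
  assumes G: "G \<in> (listed_monoids :: ('a \<Rightarrow> 'a) set set)"
  shows "maximal_clone (Pol G)" "unary ` {g. bij g} \<subseteq> Pol G" "\<not> range unary \<subseteq> Pol G"
proof -
  have u: "unary g \<in> Pol G \<longleftrightarrow> g \<in> G" for g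
    by (rule unary_in_Pol_submonoid[OF submonoid_listed[OF G]])
  show bij: "unary ` {g. bij g} \<subseteq> Pol G" using u bij_in_listed[OF G] by blast
  show nu: "\<not> range unary \<subseteq> Pol G" using u listed_neq_UNIV[OF G] by blast
  have "Pol G \<noteq> all_ops" using nu unary_in_all_ops by blast
  moreover have False if D: "clone D" "Pol G \<subset> D" "D \<subset> all_ops" for D
  proof -
    interpret perm_monoid ty D "{g. unary g \<in> D}"
      using clone_perm_monoid[OF D(1)] bij D(2) by blast
    obtain p :: "'a \<Rightarrow> 'a \<Rightarrow> 'a" and Z where p: "injective_on_square p Z" "binary p \<in> Pol G"
      using listed_ex_injective_on_square[OF G] .
    have "\<not> D \<subseteq> Pol H" if H: "H \<in> listed_monoids" for H
      using Pol_subset_imp_eq[OF G H] D(2) by blast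
    moreover have "\<not> D \<subseteq> almost_unary" "\<not> D \<subseteq> Pol large_fibre"
      using binary_notin_almost_unary[OF p(1)] binary_notin_Pol_large_fibre[OF p(1)] p(2) D(2)
      by blast+
    ultimately have "{g. unary g \<in> D} = UNIV" by (rule M_eq_UNIV)
    then have "D = all_ops" using clone_generated[OF D(1) _ _ p(1)] p(2) D(2) by blast
    then show False using D(3) by blast
  qed
  ultimately show "maximal_clone (Pol G)"
    unfolding maximal_clone_def using clone_Pol by blast
qed

end

theorem theorem1:
  assumes "infinite (UNIV :: 'a set)"
    and "regularCard |UNIV :: 'a set|"
  shows "(\<forall>G \<in> (listed_monoids :: ('a \<Rightarrow> 'a) set set). submonoid_of_functions G) \<and>
    {C :: 'a operation set. maximal_clone C \<and> unary ` {g. bij g} \<subseteq> C \<and> \<not> range unary \<subseteq> C} =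
    {Pol G | G. G \<in> listed_monoids}"
proof -
  interpret regular_universe "TYPE('a)" by unfold_locales (use assms in auto)
  show ?thesis
  proof (intro conjI ballI subset_antisym subsetI)
    fix C :: "'a operation set"
    assume "C \<in> {C. maximal_clone C \<and> unary ` {g. bij g} \<subseteq> C \<and> \<not> range unary \<subseteq> C}"
    then show "C \<in> {Pol G | G. G \<in> listed_monoids}"
      using maximal_clone_is_Pol[of C] by auto
  next
    fix C :: "'a operation set"
    assume "C \<in> {Pol G | G. G \<in> listed_monoids}"
    then obtain G where "C = Pol G" "G \<in> listed_monoids" by auto
    then show "C \<in> {C. maximal_clone C \<and> unary ` {g. bij g} \<subseteq> C \<and> \<not> range unary \<subseteq> C}"
      using maximal_clone_Pol[of G] by simp
  qed (rule submonoid_listed)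
qed

end
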